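(* Let $\rho\in\mathbb C$. Every smooth $\mathfrak{hc}$-module $W$ of level $1$ becomes a smooth $\mathfrak g$-module of central charge $\left(\frac52,-12\rho^2\right)$ with the following actions, for $n\in\mathbb Z$, $r\in\mathbb Z+\frac12$: $$L_n\mapsto\sum_{m\in\mathbb Z}{:}a_mb_{n-m}{:}-(n+1)\rho a_n-\frac12\sum_{s\in\mathbb Z+\frac12}\Big(s+\frac12\Big){:}c_sc_{n-s}{:},$$ $$M_n\mapsto\frac12\sum_{m\in\mathbb Z}b_mb_{n-m}-(n+1)\rho b_n,$$ $$Q_r\mapsto\sum_{s\in\mathbb Z+\frac12}b_{r-s}c_s-2\Big(r+\frac12\Big)\rho c_r,$$ $$\mathbf c_1\mapsto\frac52,\qquad\mathbf c_2\mapsto-12\rho^2.$$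
   Context: The N=1 BMS superalgebra $\mathfrak g$ is the complex Lie superalgebra with even basis $L_n,M_n$ ($n\in\mathbb Z$), $\mathbf c_1,\mathbf c_2$, odd basis $Q_r$ ($r\in\mathbb Z+\frac12$), and brackets $[L_m,L_n]=(m-n)L_{m+n}+\frac1{12}\delta_{m+n,0}(m^3-m)\mathbf c_1$, $[L_m,M_n]=(m-n)M_{m+n}+\frac1{12}\delta_{m+n,0}(m^3-m)\mathbf c_2$, $[Q_r,Q_s]=2M_{r+s}+\frac13\delta_{r+s,0}(r^2-\frac14)\mathbf c_2$, $[L_m,Q_r]=(\frac m2-r)Q_{m+r}$, $[M_m,M_n]=[M_n,Q_r]=0$, with $\mathbf c_1,\mathbf c_2$ central. A $\mathfrak g$-module $W$ is smooth if for every $w\in W$, $L_iw=M_iw=Q_{i-\frac12}w=0$ for all sufficiently large $i$; it has central charge $(c_1,c_2)$ if $\mathbf c_1,\mathbf c_2$ act as the scalars $c_1,c_2$. The Heisenberg-Clifford algebra $\mathfrak{hc}$ is the Lie superalgebra with even basis $a_n,b_n$ ($n\in\mathbb Z$), $\mathbf k$, odd basis $c_r$ ($r\in\mathbb Z+\frac12$), with $[a_m,b_n]=m\delta_{m+n,0}\mathbf k$, $\{c_r,c_s\}=\delta_{r+s,0}\mathbf k$, and all other brackets of basis elements zero. An $\mathfrak{hc}$-module is smooth if each vector is killed by $a_i,b_j,c_k$ for all sufficiently large $i,j,k$; it has level $\ell$ if $\mathbf k$ acts as $\ell$. Normal ordering: ${:}a_mb_n{:}=a_mb_n$ if $m<0$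 and $b_na_m$ if $m\ge0$; ${:}c_sc_r{:}=c_sc_r$ if $s<0$ and $-c_rc_s$ if $s>0$. *)

theory Defs
  imports Complex_Main "HOL-Library.Poly_Mapping"
begin

section \<open>Lie superalgebras over the complex numbers and their modules\<close>

text \<open>
  The \<open>\<int>/2\<close>-grading of a space is a family \<open>gr\<close> indexed by \<open>bool\<close>: \<open>gr False\<close> is the even part,
  \<open>gr True\<close> the odd part. The sum of the degrees \<open>p\<close> and \<open>q\<close> is then \<open>p \<noteq> q\<close>.
\<close>

locale super_space = vector_space scale
  for scale :: "complex \<Rightarrow> 'v::ab_group_add \<Rightarrow> 'v" +
  fixes gr :: "bool \<Rightarrow> 'v set"
  assumes gr_subspace: "subspace (gr p)"
    and gr_disjoint: "gr False \<inter> gr True = {0}"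
    and gr_decompose: "\<exists>u\<in>gr False. \<exists>v\<in>gr True. w = u + v"

definition koszul :: "bool \<Rightarrow> bool \<Rightarrow> complex" where
  "koszul p q = (if p \<and> q then -1 else 1)"

locale lie_superalgebra = super_space scale gr
  for scale :: "complex \<Rightarrow> 'g::ab_group_add \<Rightarrow> 'g" and gr :: "bool \<Rightarrow> 'g set" +
  fixes br :: "'g \<Rightarrow> 'g \<Rightarrow> 'g"
  assumes br_linear_right: "Vector_Spaces.linear scale scale (\<lambda>y. br x y)"
    and br_linear_left: "Vector_Spaces.linear scale scale (\<lambda>x. br x y)"
    and br_gr: "x \<in> gr p \<Longrightarrow> y \<in> gr q \<Longrightarrow> br x y \<in> gr (p \<noteq> q)"
    and br_skew: "x \<in> gr p \<Longrightarrow> y \<in> gr q \<Longrightarrow> br x y = - scale (koszul p q) (br y x)"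
    and br_jacobi: "x \<in> gr p \<Longrightarrow> y \<in> gr q \<Longrightarrow> z \<in> gr r \<Longrightarrow>
          br x (br y z) = br (br x y) z + scale (koszul p q) (br y (br x z))"

locale lie_supermodule =
  g: lie_superalgebra scale_g gr_g br + W: super_space scale gr
  for scale_g :: "complex \<Rightarrow> 'g::ab_group_add \<Rightarrow> 'g" and gr_g :: "bool \<Rightarrow> 'g set"
    and br :: "'g \<Rightarrow> 'g \<Rightarrow> 'g"
    and scale :: "complex \<Rightarrow> 'w::ab_group_add \<Rightarrow> 'w" and gr :: "bool \<Rightarrow> 'w set" +
  fixes act :: "'g \<Rightarrow> 'w \<Rightarrow> 'w"
  assumes act_linear_right: "Vector_Spaces.linear scale scale (\<lambda>w. act x w)"
    and act_linear_left: "Vector_Spaces.linear scale_g scale (\<lambda>x. act x w)"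
    and act_gr: "x \<in> gr_g p \<Longrightarrow> w \<in> gr q \<Longrightarrow> act x w \<in> gr (p \<noteq> q)"
    and act_br: "x \<in> gr_g p \<Longrightarrow> y \<in> gr_g q \<Longrightarrow>
          act (br x y) w = act x (act y w) - scale (koszul p q) (act y (act x w))"


section \<open>Superalgebras given by structure constants on a basis\<close>

text \<open>The space with basis \<open>'b\<close> is \<open>'b \<Rightarrow>\<^sub>0 complex\<close>.\<close>

abbreviation gen :: "'b \<Rightarrow> ('b \<Rightarrow>\<^sub>0 complex)" where
  "gen b \<equiv> Poly_Mapping.single b 1"

definition vscale :: "complex \<Rightarrow> ('b \<Rightarrow>\<^sub>0 complex) \<Rightarrow> ('b \<Rightarrow>\<^sub>0 complex)" where
  "vscale c x = Poly_Mapping.map ((*) c) x"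

definition free_gr :: "('b \<Rightarrow> bool) \<Rightarrow> bool \<Rightarrow> ('b \<Rightarrow>\<^sub>0 complex) set" where
  "free_gr odd_gen p = {x. \<forall>b\<in>Poly_Mapping.keys x. odd_gen b = p}"

definition bilinear_ext ::
    "('b \<Rightarrow> 'b \<Rightarrow> ('b \<Rightarrow>\<^sub>0 complex)) \<Rightarrow> ('b \<Rightarrow>\<^sub>0 complex) \<Rightarrow> ('b \<Rightarrow>\<^sub>0 complex) \<Rightarrow> ('b \<Rightarrow>\<^sub>0 complex)" where
  "bilinear_ext f x y = (\<Sum>i\<in>Poly_Mapping.keys x. \<Sum>j\<in>Poly_Mapping.keys y.
      vscale (Poly_Mapping.lookup x i * Poly_Mapping.lookup y j) (f i j))"

lemma lookup_vscale [simp]: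
  "Poly_Mapping.lookup (vscale c x) b = c * Poly_Mapping.lookup x b"
  by (simp add: vscale_def Poly_Mapping.map.rep_eq when_def)

lemma vscale_single [simp]: "vscale c (Poly_Mapping.single b d) = Poly_Mapping.single b (c * d)"
  by (rule poly_mapping_eqI) (simp add: lookup_single when_def)

lemma vector_space_vscale: "vector_space (vscale :: complex \<Rightarrow> ('b \<Rightarrow>\<^sub>0 complex) \<Rightarrow> _)"
  by unfold_locales (auto intro!: poly_mapping_eqI simp: lookup_add algebra_simps)

interpretation vs: vector_space "vscale :: complex \<Rightarrow> ('b \<Rightarrow>\<^sub>0 complex) \<Rightarrow> _"
  by (rule vector_space_vscale)

lemma bilinear_ext_superset:
  assumes "finite S" "finite T" "Poly_Mapping.keys x \<subseteq> S" "Poly_Mapping.keys y \<subseteq> T"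
  shows "bilinear_ext f x y = (\<Sum>i\<in>S. \<Sum>j\<in>T.
      vscale (Poly_Mapping.lookup x i * Poly_Mapping.lookup y j) (f i j))"
proof -
  have "(\<Sum>j\<in>Poly_Mapping.keys y. vscale (Poly_Mapping.lookup x i * Poly_Mapping.lookup y j) (f i j))
      = (\<Sum>j\<in>T. vscale (Poly_Mapping.lookup x i * Poly_Mapping.lookup y j) (f i j))" for i
    by (rule sum.mono_neutral_left) (use assms in \<open>auto simp: in_keys_iff\<close>)
  moreover have "(\<Sum>i\<in>Poly_Mapping.keys x. \<Sum>j\<in>T. vscale (Poly_Mapping.lookup x i * Poly_Mapping.lookup y j) (f i j))
      = (\<Sum>i\<in>S. \<Sum>j\<in>T. vscale (Poly_Mapping.lookup x i * Poly_Mapping.lookup y j) (f i j))"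
    by (rule sum.mono_neutral_left) (use assms in \<open>auto simp: in_keys_iff\<close>)
  ultimately show ?thesis by (simp add: bilinear_ext_def)
qed

lemma keys_vscale: "Poly_Mapping.keys (vscale c x) \<subseteq> Poly_Mapping.keys x"
  by (auto simp: in_keys_iff)

lemma bilinear_ext_add_left: "bilinear_ext f (x + x') y = bilinear_ext f x y + bilinear_ext f x' y"
proof -
  let ?S = "Poly_Mapping.keys x \<union> Poly_Mapping.keys x'"
  note * = bilinear_ext_superset[of ?S "Poly_Mapping.keys y" _ y]
  show ?thesis
    by (subst (1 2 3) *)
       (use keys_add[of x x'] in
         \<open>auto simp: lookup_add algebra_simps vs.scale_left_distrib sum.distrib\<close>)
qed

lemma bilinear_ext_add_right: "bilinear_ext f x (y + y') = bilinear_ext f x y + bilinear_ext f x y'"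
proof -
  let ?S = "Poly_Mapping.keys y \<union> Poly_Mapping.keys y'"
  note * = bilinear_ext_superset[of "Poly_Mapping.keys x" ?S x]
  show ?thesis
    by (subst (1 2 3) *)
       (use keys_add[of y y'] in
         \<open>auto simp: lookup_add algebra_simps vs.scale_left_distrib sum.distrib\<close>)
qed

lemma bilinear_ext_scale_left: "bilinear_ext f (vscale c x) y = vscale c (bilinear_ext f x y)"
proof -
  note * = bilinear_ext_superset[of "Poly_Mapping.keys x" "Poly_Mapping.keys y" _ y]
  show ?thesis
    by (subst (1 2) *) (auto simp: keys_vscale vs.scale_sum_right mult_ac)
qed

lemma bilinear_ext_scale_right: "bilinear_ext f x (vscale c y) = vscale c (bilinear_ext f x y)"
proof -
  note * = bilinear_ext_superset[of "Poly_Mapping.keys x" "Poly_Mapping.keys y" x]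
  show ?thesis
    by (subst (1 2) *) (auto simp: keys_vscale vs.scale_sum_right mult_ac)
qed

lemma bilinear_ext_single [simp]:
  "bilinear_ext f (Poly_Mapping.single i c) (Poly_Mapping.single j d) = vscale (c * d) (f i j)"
  by (subst bilinear_ext_superset[of "{i}" "{j}"]) auto

lemma bilinear_ext_zero_left [simp]: "bilinear_ext f 0 y = 0"
  by (simp add: bilinear_ext_def)

lemma bilinear_ext_zero_right [simp]: "bilinear_ext f x 0 = 0"
  by (simp add: bilinear_ext_def)

lemma bilinear_ext_uminus_left: "bilinear_ext f (- x) y = - bilinear_ext f x y"
  using bilinear_ext_scale_left[of f "-1" x y] by simp

lemma bilinear_ext_uminus_right: "bilinear_ext f x (- y) = - bilinear_ext f x y"
  using bilinear_ext_scale_right[of f x "-1" y] by simp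

lemma bilinear_ext_diff_left: "bilinear_ext f (x - x') y = bilinear_ext f x y - bilinear_ext f x' y"
  using bilinear_ext_add_left[of f x "- x'" y] by (simp add: bilinear_ext_uminus_left)

lemma bilinear_ext_diff_right: "bilinear_ext f x (y - y') = bilinear_ext f x y - bilinear_ext f x y'"
  using bilinear_ext_add_right[of f x y "- y'"] by (simp add: bilinear_ext_uminus_right)

lemmas bilinear_ext_linear =
  bilinear_ext_add_left bilinear_ext_scale_left bilinear_ext_uminus_left bilinear_ext_diff_left
  bilinear_ext_add_right bilinear_ext_scale_right bilinear_ext_uminus_right bilinear_ext_diff_right

lemma free_expand: "x = (\<Sum>b\<in>Poly_Mapping.keys x. vscale (Poly_Mapping.lookup x b) (gen b))"
proof (rule poly_mapping_eqI)
  fix k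
  show "Poly_Mapping.lookup x k = Poly_Mapping.lookup
    (\<Sum>b\<in>Poly_Mapping.keys x. vscale (Poly_Mapping.lookup x b) (gen b)) k"
    by (auto simp: lookup_sum lookup_single when_def sum.delta in_keys_iff)
qed

lemma free_gr_induct [consumes 1, case_names zero add single]:
  assumes "x \<in> free_gr od p" "P 0" "\<And>u v. P u \<Longrightarrow> P v \<Longrightarrow> P (u + v)"
    "\<And>b c. od b = p \<Longrightarrow> P (vscale c (gen b))"
  shows "P x"
proof -
  have "P (\<Sum>b\<in>S. vscale (Poly_Mapping.lookup x b) (gen b))"
    if "finite S" "S \<subseteq> Poly_Mapping.keys x" for S
    using that
  proof (induction S rule: finite_induct)
    case empty
    then show ?case by (simp add: assms(2))
  next
    case (insert b S)
    then have "od b = p" using assms(1) by (auto simp: free_gr_def)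
    with insert show ?case
      using assms(3,4) by (simp del: vscale_single)
  qed
  from this[OF finite_keys order_refl] show ?thesis by (simp only: free_expand[symmetric])
qed

lemma super_space_free: "super_space vscale (free_gr od)"
proof -
  have sub: "vs.subspace (free_gr od p)" for p
    unfolding vs.subspace_def free_gr_def
    using keys_vscale keys_add by fastforce
  have disj: "free_gr od False \<inter> free_gr od True = {0}"
  proof -
    have "x = 0" if "x \<in> free_gr od False" "x \<in> free_gr od True" for x
      using that by (auto simp: free_gr_def)
    then show ?thesis by (auto simp: free_gr_def)
  qed
  have dec: "\<exists>u\<in>free_gr od False. \<exists>v\<in>free_gr od True. w = u + v" for w
  proof -
    define f where "f = (\<lambda>b. vscale (Poly_Mapping.lookup w b) (gen b))"
    define K where "K = (\<lambda>p. {b \<in> Poly_Mapping.keys w. od b = p})"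
    have "sum f (K p) \<in> free_gr od p" for p
      by (rule vs.subspace_sum[OF sub]) (auto simp: K_def f_def free_gr_def)
    moreover have "w = sum f (K False) + sum f (K True)"
    proof -
      have "w = sum f (Poly_Mapping.keys w)"
        unfolding f_def by (rule free_expand)
      also have "Poly_Mapping.keys w = K False \<union> K True"
        by (auto simp: K_def)
      also have "sum f (K False \<union> K True) = sum f (K False) + sum f (K True)"
        by (rule sum.union_disjoint) (auto simp: K_def)
      finally show ?thesis .
    qed
    ultimately show ?thesis by blast
  qed
  show ?thesis
    by (intro super_space.intro super_space_axioms.intro vector_space_vscale sub disj dec)
qed

lemma koszul_sq [simp]: "koszul p q * koszul p q = 1"
  by (simp add: koszul_def)

lemma lie_superalgebra_structure_constants:
  assumes gr: "\<And>i j. f i j \<in> free_gr od (od i \<noteq> od j)"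
    and skew: "\<And>i j. f i j = - vscale (koszul (od i) (od j)) (f j i)"
    and jac: "\<And>i j k. bilinear_ext f (gen i) (f j k) = bilinear_ext f (f i j) (gen k)
        + vscale (koszul (od i) (od j)) (bilinear_ext f (gen j) (f i k))"
  shows "lie_superalgebra vscale (free_gr od) (bilinear_ext f)"
proof -
  interpret F: super_space vscale "free_gr od" by (rule super_space_free)
  note bil = bilinear_ext_linear
  have "Vector_Spaces.linear vscale vscale (\<lambda>y. bilinear_ext f x y)"
    "Vector_Spaces.linear vscale vscale (\<lambda>x. bilinear_ext f x y)" for x y
    by (simp_all add: Vector_Spaces.linear_iff bil vector_space_vscale)
  moreover have "bilinear_ext f x y \<in> free_gr od (p \<noteq> q)"
    if "x \<in> free_gr od p" "y \<in> free_gr od q" for x y p q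
    using that
  proof (induction rule: free_gr_induct)
    case zero
    then show ?case by (simp add: vs.subspace_0[OF F.gr_subspace])
  next
    case (add u v)
    then show ?case by (simp add: bil vs.subspace_add[OF F.gr_subspace])
  next
    case (single b c)
    from single(2,1) show ?case
    proof (induction rule: free_gr_induct)
      case zero
      then show ?case by (simp add: vs.subspace_0[OF F.gr_subspace])
    next
      case (add u v)
      then show ?case by (simp add: bil vs.subspace_add[OF F.gr_subspace])
    next
      case (single b' c')
      then show ?case using gr[of b b'] by (simp add: vs.subspace_scale[OF F.gr_subspace])
    qed
  qed
  moreover have "bilinear_ext f x y = - vscale (koszul p q) (bilinear_ext f y x)"
    if "x \<in> free_gr od p" "y \<in> free_gr od q" for x y p q
    using that
  proof (induction rule: free_gr_induct)
    case zero
    then show ?case by simp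
  next
    case (add u v)
    then show ?case by (simp add: bil vs.scale_right_distrib)
  next
    case (single b c)
    from single(2,1) show ?case
    proof (induction rule: free_gr_induct)
      case zero
      then show ?case by simp
    next
      case (add u v)
      then show ?case by (simp add: bil vs.scale_right_distrib)
    next
      case (single b' c')
      then show ?case using arg_cong[OF skew[of b b'], of "vscale (c * c')"]
        by (simp add: mult_ac)
    qed
  qed
  moreover have "bilinear_ext f x (bilinear_ext f y z) = bilinear_ext f (bilinear_ext f x y) z
      + vscale (koszul p q) (bilinear_ext f y (bilinear_ext f x z))"
    if "x \<in> free_gr od p" "y \<in> free_gr od q" "z \<in> free_gr od r" for x y z p q r
    using that
  proof (induction rule: free_gr_induct)
    case zero
    then show ?case by simp
  next
    case (add u v)
    then show ?case by (simp add: bil vs.scale_right_distrib)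
  next
    case (single b c)
    from single(2,1,3) show ?case
    proof (induction rule: free_gr_induct)
      case zero
      then show ?case by simp
    next
      case (add u v)
      then show ?case by (simp add: bil vs.scale_right_distrib)
    next
      case (single b' c')
      from single(3,1,2) show ?case
      proof (induction rule: free_gr_induct)
        case zero
        then show ?case by simp
      next
        case (add u v)
        then show ?case by (simp add: bil vs.scale_right_distrib)
      next
        case (single b'' c'')
        have "bilinear_ext f (vscale c (gen b))
              (bilinear_ext f (vscale c' (gen b')) (vscale c'' (gen b'')))
            = vscale (c * c' * c'') (bilinear_ext f (gen b) (f b' b''))"
          by (simp add: bil mult_ac del: vscale_single)
        moreover have "bilinear_ext f (bilinear_ext f (vscale c (gen b)) (vscale c' (gen b')))
              (vscale c'' (gen b''))
            = vscale (c * c' * c'') (bilinear_ext f (f b b') (gen b''))"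
          by (simp add: bil mult_ac del: vscale_single)
        moreover have "bilinear_ext f (vscale c' (gen b'))
              (bilinear_ext f (vscale c (gen b)) (vscale c'' (gen b'')))
            = vscale (c * c' * c'') (bilinear_ext f (gen b') (f b b''))"
          by (simp add: bil mult_ac del: vscale_single)
        ultimately show ?case using single jac[of b b' b'']
          by (simp add: vs.scale_right_distrib mult_ac del: vscale_single)
      qed
    qed
  qed
  ultimately show ?thesis
    by (intro lie_superalgebra.intro lie_superalgebra_axioms.intro super_space_free)
qed


section \<open>The \<open>N = 1\<close> BMS superalgebra\<close>

text \<open>
  Half-integers are coded by integers: \<open>half k = k + 1/2\<close>. The generator \<open>gQ k\<close> is the element
  usually written $Q_{k+1/2}$ and \<open>hC k\<close> is $c_{k+1/2}$. Accordingly \<open>half j + half k = j + k + 1\<close>,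
  \<open>m + half k = half (m + k)\<close>, \<open>half j - half k = j - k\<close> and \<open>n - half k = half (n - 1 - k)\<close>.
\<close>

definition half :: "int \<Rightarrow> complex" where
  "half k = of_int k + 1 / 2"

datatype bms = gL int | gM int | gQ int | gC1 | gC2

fun bms_odd :: "bms \<Rightarrow> bool" where
  "bms_odd (gQ k) = True"
| "bms_odd _ = False"

definition central_term :: "int \<Rightarrow> int \<Rightarrow> complex" where
  "central_term m n = (if m + n = 0 then (of_int m ^ 3 - of_int m) / 12 else 0)"

definition central_term_odd :: "int \<Rightarrow> int \<Rightarrow> complex" where
  "central_term_odd j k = (if j + k + 1 = 0 then ((half j)\<^sup>2 - 1 / 4) / 3 else 0)"

fun bms_br_gen :: "bms \<Rightarrow> bms \<Rightarrow> (bms \<Rightarrow>\<^sub>0 complex)" where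
  "bms_br_gen (gL m) (gL n) = vscale (of_int (m - n)) (gen (gL (m + n))) + vscale (central_term m n) (gen gC1)"
| "bms_br_gen (gL m) (gM n) = vscale (of_int (m - n)) (gen (gM (m + n))) + vscale (central_term m n) (gen gC2)"
| "bms_br_gen (gM n) (gL m) = - (vscale (of_int (m - n)) (gen (gM (m + n))) + vscale (central_term m n) (gen gC2))"
| "bms_br_gen (gL m) (gQ k) = vscale (of_int m / 2 - half k) (gen (gQ (m + k)))"
| "bms_br_gen (gQ k) (gL m) = - vscale (of_int m / 2 - half k) (gen (gQ (m + k)))"
| "bms_br_gen (gQ j) (gQ k) = vscale 2 (gen (gM (j + k + 1)))
     + vscale (central_term_odd j k) (gen gC2)"
| "bms_br_gen _ _ = 0"

abbreviation bms_gr :: "bool \<Rightarrow> (bms \<Rightarrow>\<^sub>0 complex) set" where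
  "bms_gr \<equiv> free_gr bms_odd"

abbreviation bms_br :: "(bms \<Rightarrow>\<^sub>0 complex) \<Rightarrow> (bms \<Rightarrow>\<^sub>0 complex) \<Rightarrow> (bms \<Rightarrow>\<^sub>0 complex)" where
  "bms_br \<equiv> bilinear_ext bms_br_gen"

abbreviation bms_module ::
    "(complex \<Rightarrow> 'w::ab_group_add \<Rightarrow> 'w) \<Rightarrow> (bool \<Rightarrow> 'w set) \<Rightarrow> ((bms \<Rightarrow>\<^sub>0 complex) \<Rightarrow> 'w \<Rightarrow> 'w) \<Rightarrow> bool" where
  "bms_module \<equiv> lie_supermodule vscale bms_gr bms_br"

text \<open>\<open>gQ (i - 1)\<close> is $Q_{i-1/2}$.\<close>

definition bms_smooth :: "((bms \<Rightarrow>\<^sub>0 complex) \<Rightarrow> 'w::ab_group_add \<Rightarrow> 'w) \<Rightarrow> bool" where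
  "bms_smooth act \<longleftrightarrow> (\<forall>w. \<forall>\<^sub>F i in at_top.
     act (gen (gL i)) w = 0 \<and> act (gen (gM i)) w = 0 \<and> act (gen (gQ (i - 1))) w = 0)"

definition bms_central_charge ::
    "(complex \<Rightarrow> 'w::ab_group_add \<Rightarrow> 'w) \<Rightarrow> ((bms \<Rightarrow>\<^sub>0 complex) \<Rightarrow> 'w \<Rightarrow> 'w) \<Rightarrow> complex \<Rightarrow> complex \<Rightarrow> bool" where
  "bms_central_charge scale act c1 c2 \<longleftrightarrow>
     (\<forall>w. act (gen gC1) w = scale c1 w \<and> act (gen gC2) w = scale c2 w)"

lemma central_term_swap: "central_term m n = - central_term n m"
proof (cases "m + n = 0")
  case True
  then have "n = - m" by simp
  then show ?thesis by (simp add: central_term_def field_simps)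
qed (simp add: central_term_def add.commute)

lemma central_term_odd_swap: "central_term_odd j k = central_term_odd k j"
proof (cases "j + k + 1 = 0")
  case True
  then have "k = - j - 1" by simp
  show ?thesis unfolding \<open>k = - j - 1\<close>
    by (simp add: central_term_odd_def half_def power2_eq_square algebra_simps)
qed (simp add: central_term_odd_def add.commute)

definition bms_jacobi :: "bms \<Rightarrow> bms \<Rightarrow> bms \<Rightarrow> bool" where
  "bms_jacobi i j k \<longleftrightarrow> bms_br (gen i) (bms_br_gen j k) = bms_br (bms_br_gen i j) (gen k)
        + vscale (koszul (bms_odd i) (bms_odd j)) (bms_br (gen j) (bms_br_gen i k))"

lemmas bms_jacobi_simps = bms_jacobi_def koszul_def bilinear_ext_linear vs.scale_right_distrib vs.scale_right_diff_distrib

lemmas bms_coeff_simps = lookup_add lookup_minus lookup_single when_def central_term_def central_term_odd_def half_def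
  power2_eq_square power3_eq_cube

lemma bms_jacobi_LLL: "bms_jacobi (gL a) (gL b) (gL c)"
proof -
  define d where "d = a + b + c"
  have c: "c = d - a - b" by (simp add: d_def)
  show ?thesis unfolding c
    by (simp add: bms_jacobi_simps, rule poly_mapping_eqI)
       (auto simp: bms_coeff_simps field_simps)
qed

lemma bms_jacobi_LLM: "bms_jacobi (gL a) (gL b) (gM c)"
proof -
  define d where "d = a + b + c"
  have c: "c = d - a - b" by (simp add: d_def)
  show ?thesis unfolding c
    by (simp add: bms_jacobi_simps, rule poly_mapping_eqI)
       (auto simp: bms_coeff_simps field_simps)
qed

lemma bms_jacobi_LML: "bms_jacobi (gL a) (gM b) (gL c)"
proof -
  define d where "d = a + b + c"
  have c: "c = d - a - b" by (simp add: d_def)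
  show ?thesis unfolding c
    by (simp add: bms_jacobi_simps, rule poly_mapping_eqI)
       (auto simp: bms_coeff_simps field_simps)
qed

lemma bms_jacobi_MLL: "bms_jacobi (gM a) (gL b) (gL c)"
proof -
  define d where "d = a + b + c"
  have c: "c = d - a - b" by (simp add: d_def)
  show ?thesis unfolding c
    by (simp add: bms_jacobi_simps, rule poly_mapping_eqI)
       (auto simp: bms_coeff_simps field_simps)
qed

lemma bms_jacobi_LLQ: "bms_jacobi (gL a) (gL b) (gQ c)"
proof -
  define d where "d = a + b + c"
  have c: "c = d - a - b" by (simp add: d_def)
  show ?thesis unfolding c
    by (simp add: bms_jacobi_simps, rule poly_mapping_eqI)
       (auto simp: bms_coeff_simps field_simps)
qed

lemma bms_jacobi_LQL: "bms_jacobi (gL a) (gQ b) (gL c)"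
proof -
  define d where "d = a + b + c"
  have c: "c = d - a - b" by (simp add: d_def)
  show ?thesis unfolding c
    by (simp add: bms_jacobi_simps, rule poly_mapping_eqI)
       (auto simp: bms_coeff_simps field_simps)
qed

lemma bms_jacobi_QLL: "bms_jacobi (gQ a) (gL b) (gL c)"
proof -
  define d where "d = a + b + c"
  have c: "c = d - a - b" by (simp add: d_def)
  show ?thesis unfolding c
    by (simp add: bms_jacobi_simps, rule poly_mapping_eqI)
       (auto simp: bms_coeff_simps field_simps)
qed

lemma bms_jacobi_LQQ: "bms_jacobi (gL a) (gQ b) (gQ c)"
proof -
  define d where "d = a + b + c + 1"
  have c: "c = d - a - b - 1" by (simp add: d_def)
  show ?thesis unfolding c
    by (simp add: bms_jacobi_simps, rule poly_mapping_eqI)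
       (auto simp: bms_coeff_simps field_simps)
qed

lemma bms_jacobi_QLQ: "bms_jacobi (gQ a) (gL b) (gQ c)"
proof -
  define d where "d = a + b + c + 1"
  have c: "c = d - a - b - 1" by (simp add: d_def)
  show ?thesis unfolding c
    by (simp add: bms_jacobi_simps, rule poly_mapping_eqI)
       (auto simp: bms_coeff_simps field_simps)
qed

lemma bms_jacobi_QQL: "bms_jacobi (gQ a) (gQ b) (gL c)"
proof -
  define d where "d = a + b + c + 1"
  have c: "c = d - a - b - 1" by (simp add: d_def)
  show ?thesis unfolding c
    by (simp add: bms_jacobi_simps, rule poly_mapping_eqI)
       (auto simp: bms_coeff_simps field_simps)
qed

lemma bms_jacobi_all: "bms_jacobi i j k"
  by (cases i; cases j; cases k) (simp_all add: 
      bms_jacobi_LLL bms_jacobi_LLM bms_jacobi_LML bms_jacobi_MLL bms_jacobi_LLQ bms_jacobi_LQL bms_jacobi_QLL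
      bms_jacobi_LQQ bms_jacobi_QLQ bms_jacobi_QQL, simp_all add: bms_jacobi_simps)

lemma bms_lie_superalgebra: "lie_superalgebra vscale bms_gr bms_br"
proof (rule lie_superalgebra_structure_constants)
  fix i j
  show "bms_br_gen i j \<in> bms_gr (bms_odd i \<noteq> bms_odd j)"
    by (cases "(i, j)" rule: bms_br_gen.cases)
       (auto simp: free_gr_def in_keys_iff lookup_add lookup_single lookup_uminus lookup_minus when_def split: if_splits)
  show "bms_br_gen i j = - vscale (koszul (bms_odd i) (bms_odd j)) (bms_br_gen j i)"
    by (cases i; cases j)
       (auto intro!: poly_mapping_eqI simp: koszul_def lookup_add lookup_single when_def
         algebra_simps intro: central_term_swap central_term_odd_swap)
next
  fix i j k
  show "bms_br (gen i) (bms_br_gen j k) = bms_br (bms_br_gen i j) (gen k)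
        + vscale (koszul (bms_odd i) (bms_odd j)) (bms_br (gen j) (bms_br_gen i k))"
    using bms_jacobi_all[of i j k] by (simp only: bms_jacobi_def)
qed


section \<open>The Heisenberg-Clifford algebra\<close>

datatype hc = hA int | hB int | hC int | hK

fun hc_odd :: "hc \<Rightarrow> bool" where
  "hc_odd (hC k) = True"
| "hc_odd _ = False"

fun hc_br_gen :: "hc \<Rightarrow> hc \<Rightarrow> (hc \<Rightarrow>\<^sub>0 complex)" where
  "hc_br_gen (hA m) (hB n) = vscale (if m + n = 0 then of_int m else 0) (gen hK)"
| "hc_br_gen (hB n) (hA m) = - vscale (if m + n = 0 then of_int m else 0) (gen hK)"
| "hc_br_gen (hC j) (hC k) = vscale (if j + k + 1 = 0 then 1 else 0) (gen hK)"
| "hc_br_gen _ _ = 0"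

abbreviation hc_gr :: "bool \<Rightarrow> (hc \<Rightarrow>\<^sub>0 complex) set" where
  "hc_gr \<equiv> free_gr hc_odd"

abbreviation hc_br :: "(hc \<Rightarrow>\<^sub>0 complex) \<Rightarrow> (hc \<Rightarrow>\<^sub>0 complex) \<Rightarrow> (hc \<Rightarrow>\<^sub>0 complex)" where
  "hc_br \<equiv> bilinear_ext hc_br_gen"

abbreviation hc_module ::
    "(complex \<Rightarrow> 'w::ab_group_add \<Rightarrow> 'w) \<Rightarrow> (bool \<Rightarrow> 'w set) \<Rightarrow> ((hc \<Rightarrow>\<^sub>0 complex) \<Rightarrow> 'w \<Rightarrow> 'w) \<Rightarrow> bool" where
  "hc_module \<equiv> lie_supermodule vscale hc_gr hc_br"

definition hc_smooth :: "((hc \<Rightarrow>\<^sub>0 complex) \<Rightarrow> 'w::ab_group_add \<Rightarrow> 'w) \<Rightarrow> bool" where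
  "hc_smooth act \<longleftrightarrow> (\<forall>w.
     (\<forall>\<^sub>F i in at_top. act (gen (hA i)) w = 0) \<and>
     (\<forall>\<^sub>F i in at_top. act (gen (hB i)) w = 0) \<and>
     (\<forall>\<^sub>F i in at_top. act (gen (hC i)) w = 0))"

definition hc_level ::
    "(complex \<Rightarrow> 'w::ab_group_add \<Rightarrow> 'w) \<Rightarrow> ((hc \<Rightarrow>\<^sub>0 complex) \<Rightarrow> 'w \<Rightarrow> 'w) \<Rightarrow> complex \<Rightarrow> bool" where
  "hc_level scale act l \<longleftrightarrow> (\<forall>w. act (gen hK) w = scale l w)"

text \<open>\<open>normal_ab act m n\<close> is the operator $:a_m b_n:$.\<close>

definition normal_ab ::
    "((hc \<Rightarrow>\<^sub>0 complex) \<Rightarrow> 'w::ab_group_add \<Rightarrow> 'w) \<Rightarrow> int \<Rightarrow> int \<Rightarrow> 'w \<Rightarrow> 'w" where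
  "normal_ab act m n w =
     (if m < 0 then act (gen (hA m)) (act (gen (hB n)) w)
      else act (gen (hB n)) (act (gen (hA m)) w))"

text \<open>
  \<open>normal_cc act j k\<close> is the operator $:c_s c_r:$ with $s = j + 1/2$, $r = k + 1/2$; so $s < 0$ means
  \<open>j < 0\<close>.
\<close>

definition normal_cc ::
    "((hc \<Rightarrow>\<^sub>0 complex) \<Rightarrow> 'w::ab_group_add \<Rightarrow> 'w) \<Rightarrow> int \<Rightarrow> int \<Rightarrow> 'w \<Rightarrow> 'w" where
  "normal_cc act j k w =
     (if j < 0 then act (gen (hC j)) (act (gen (hC k)) w)
      else - act (gen (hC k)) (act (gen (hC j)) w))"

lemma hc_lie_superalgebra: "lie_superalgebra vscale hc_gr hc_br"
proof (rule lie_superalgebra_structure_constants)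
  fix i j
  show "hc_br_gen i j \<in> hc_gr (hc_odd i \<noteq> hc_odd j)"
    by (cases i; cases j)
       (auto simp: free_gr_def in_keys_iff lookup_add lookup_single lookup_uminus lookup_minus when_def split: if_splits)
  show "hc_br_gen i j = - vscale (koszul (hc_odd i) (hc_odd j)) (hc_br_gen j i)"
    by (cases i; cases j)
       (auto intro!: poly_mapping_eqI simp: koszul_def lookup_single when_def)
next
  fix i j k
  have l: "hc_br (gen i) (hc_br_gen j k) = 0" for i j k
    by (cases i; cases j; cases k) (auto simp: bilinear_ext_linear)
  have r: "hc_br (hc_br_gen j k) (gen i) = 0" for i j k
    by (cases i; cases j; cases k) (auto simp: bilinear_ext_linear)
  show "hc_br (gen i) (hc_br_gen j k) = hc_br (hc_br_gen i j) (gen k)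
        + vscale (koszul (hc_odd i) (hc_odd j)) (hc_br (gen j) (hc_br_gen i k))"
    by (simp add: l r)
qed

end

theory Submission
  imports Defs
begin

text \<open>
  Let \<open>T\<sub>n\<close>, \<open>P\<sub>n\<close>, \<open>S\<sub>r\<close> be the operators in the statement without their \<open>\<rho>\<close>-terms. Bracketing \<open>T\<sub>n\<close> with a
  single mode gives \<open>[T\<sub>m, a\<sub>k] = -k a\<sub>m\<sub>+\<sub>k\<close>, \<open>[T\<sub>m, b\<sub>k] = -k b\<sub>m\<sub>+\<sub>k\<close> and \<open>[T\<sub>m, c\<sub>r] = -(m/2 + r) c\<sub>m\<sub>+\<sub>r\<close>, so \<open>T\<sub>m\<close> acts as
  a derivation that shifts modes. Applied termwise to a normally ordered sum it reproduces such a
  sum up to finitely many reorderings, whose total is the anomaly \<open>(m\<^sup>3 - m)/6\<close> for the \<open>a, b\<close> part of \<open>T\<close>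
  and \<open>(m\<^sup>3 - m)/24\<close> for the \<open>c\<close> part, together \<open>5/2\<close> times \<open>(m\<^sup>3 - m)/12\<close>. The \<open>\<rho>\<close>-terms are linear in the modes
  and contribute only \<open>-12\<rho>\<^sup>2\<close> to the second central charge.
\<close>

section \<open>Finitely supported sums over the integers\<close>

lemma Sum_any_shift:
  fixes f :: "int \<Rightarrow> 'a::comm_monoid_add"
  shows "Sum_any (\<lambda>k. f (k + c)) = Sum_any f"
  by (rule sym, rule Sum_any.reindex_cong[where l = "\<lambda>k. k + c"])
     (auto simp: fun_eq_iff intro!: bijI' intro: exI[of _ "_ - c"])

lemma Sum_any_reflect:
  fixes f :: "int \<Rightarrow> 'a::comm_monoid_add"
  shows "Sum_any (\<lambda>k. f (c - k)) = Sum_any f"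
  by (rule sym, rule Sum_any.reindex_cong[where l = "\<lambda>k. c - k"])
     (auto simp: fun_eq_iff intro!: bijI' intro: exI[of _ "c - _"])

lemma (in additive) Sum_any:
  assumes "finite {k. g k \<noteq> 0}"
  shows "f (Sum_any g) = Sum_any (\<lambda>k. f (g k))"
proof -
  have "{k. f (g k) \<noteq> 0} \<subseteq> {k. g k \<noteq> 0}" by (auto simp: zero)
  from Sum_any.expand_superset[OF assms this] show ?thesis
    by (simp only: Sum_any.expand_set sum)
qed

lemma finite_support_add:
  fixes f g :: "'b \<Rightarrow> 'a::comm_monoid_add"
  assumes "finite {k. f k \<noteq> 0}" "finite {k. g k \<noteq> 0}"
  shows "finite {k. f k + g k \<noteq> 0}"
  by (rule finite_subset[OF _ finite_UnI[OF assms]]) auto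

lemma eventually_at_top_int_shift:
  assumes "\<forall>\<^sub>F n :: int in at_top. R n"
  shows "\<forall>\<^sub>F n in at_top. R (n - c)"
proof -
  obtain N where "\<forall>n\<ge>N. R n" using assms by (auto simp: eventually_at_top_linorder)
  then show ?thesis unfolding eventually_at_top_linorder by (intro exI[of _ "N + c"]) simp
qed

section \<open>Normally ordered sums\<close>

definition smooth_modes :: "(int \<Rightarrow> 'w::ab_group_add \<Rightarrow> 'w) \<Rightarrow> bool" where
  "smooth_modes U \<longleftrightarrow> (\<forall>w. \<forall>\<^sub>F k in at_top. U k w = 0)"

locale operator_space = vector_space scale
  for scale :: "'a::field \<Rightarrow> 'b::ab_group_add \<Rightarrow> 'b" (infixr \<open>*s\<close> 75)
begin

abbreviation linear_op :: "('b \<Rightarrow> 'b) \<Rightarrow> bool" where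
  "linear_op \<equiv> Vector_Spaces.linear scale scale"

lemma linear_op_iff:
  "linear_op D \<longleftrightarrow> (\<forall>x y. D (x + y) = D x + D y) \<and> (\<forall>c x. D (c *s x) = c *s D x)"
  using vector_space_axioms by (auto simp: Vector_Spaces.linear_iff)

lemma linear_opD:
  assumes "linear_op D"
  shows "D (x + y) = D x + D y" "D (c *s x) = c *s D x" "D 0 = 0" "D (- x) = - D x"
    "D (x - y) = D x - D y"
proof -
  interpret additive D using assms by unfold_locales (simp add: linear_op_iff)
  show "D (x + y) = D x + D y" "D 0 = 0" "D (- x) = - D x" "D (x - y) = D x - D y"
    by (rule add zero minus diff)+
  show "D (c *s x) = c *s D x" using assms by (simp add: linear_op_iff)
qed

lemma linear_op_Sum_any:
  assumes "linear_op D" "finite {k. g k \<noteq> 0}"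
  shows "D (Sum_any g) = Sum_any (\<lambda>k. D (g k))"
proof -
  interpret additive D using assms(1) by unfold_locales (simp add: linear_op_iff)
  show ?thesis using assms(2) by (rule Sum_any)
qed

lemma linear_op_scale: "linear_op (\<lambda>w. c *s w)"
  by (simp add: linear_op_iff scale_right_distrib mult.commute)

lemma scale_Sum_any: "finite {k. g k \<noteq> 0} \<Longrightarrow> c *s Sum_any g = Sum_any (\<lambda>k. c *s g k)"
  by (rule linear_op_Sum_any[OF linear_op_scale])

lemma Sum_any_delta_scale:
  "Sum_any (\<lambda>k. (if k = a then c else 0) *s F k) = c *s F (a :: int)"
proof -
  have "Sum_any (\<lambda>k. (if k = a then c else 0) *s F k) = Sum_any (\<lambda>k. if k = a then c *s F k else 0)"
    by (rule Sum_any.cong) simp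
  then show ?thesis by simp
qed

text \<open>The sign \<open>\<epsilon>\<close> is \<open>1\<close> if one of the two fields is even and \<open>-1\<close> if both are odd.\<close>

definition nprod :: "'a \<Rightarrow> (int \<Rightarrow> 'b \<Rightarrow> 'b) \<Rightarrow> (int \<Rightarrow> 'b \<Rightarrow> 'b) \<Rightarrow> int \<Rightarrow> int \<Rightarrow> 'b \<Rightarrow> 'b" where
  "nprod \<epsilon> U V i j w = (if i < 0 then U i (V j w) else \<epsilon> *s V j (U i w))"

definition nsum ::
    "'a \<Rightarrow> (int \<Rightarrow> 'a) \<Rightarrow> (int \<Rightarrow> 'b \<Rightarrow> 'b) \<Rightarrow> (int \<Rightarrow> 'b \<Rightarrow> 'b) \<Rightarrow> int \<Rightarrow> 'b \<Rightarrow> 'b" where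
  "nsum \<epsilon> f U V n w = Sum_any (\<lambda>k. f k *s nprod \<epsilon> U V k (n - k) w)"

end

locale mode_pair = operator_space scale
  for scale :: "'a::field \<Rightarrow> 'b::ab_group_add \<Rightarrow> 'b" (infixr \<open>*s\<close> 75) +
  fixes U V :: "int \<Rightarrow> 'b \<Rightarrow> 'b"
  assumes linear_U: "linear_op (U k)" and linear_V: "linear_op (V k)"
    and smooth_U: "smooth_modes U" and smooth_V: "smooth_modes V"
begin

lemmas UV_linear = linear_opD[OF linear_U] linear_opD[OF linear_V]

lemma nprod_linear: "linear_op (nprod \<epsilon> U V i j)"
  by (simp add: linear_op_iff nprod_def UV_linear scale_right_distrib mult.commute)

text \<open>The inner factor kills \<open>w\<close> at both ends: for \<open>k < 0\<close> it is
  \<open>V\<close>, whose index \<open>n - k\<close> grows as \<open>k\<close> decreases, and for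
  \<open>k \<ge> 0\<close> it is \<open>U\<close>. Normal ordering is what makes the sum
  finite.\<close>

lemma finite_nprod: "finite {k. nprod \<epsilon> U V k (n - k) w \<noteq> 0}"
proof -
  obtain K where "U k w = 0" if "k \<ge> K" for k
    using smooth_U by (auto simp: smooth_modes_def eventually_at_top_linorder)
  moreover obtain K' where "V k w = 0" if "k \<ge> K'" for k
    using smooth_V by (auto simp: smooth_modes_def eventually_at_top_linorder)
  ultimately have "nprod \<epsilon> U V k (n - k) w = 0" if "k \<notin> {min 0 (n - K')..max 0 K}" for k
    using that by (auto simp: nprod_def UV_linear)
  then have "{k. nprod \<epsilon> U V k (n - k) w \<noteq> 0} \<subseteq> {min 0 (n - K')..max 0 K}"
    by blast
  then show ?thesis by (rule finite_subset) simp
qed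

lemma finite_nsum: "finite {k. f k *s nprod \<epsilon> U V k (n - k) w \<noteq> 0}"
  by (rule finite_subset[OF _ finite_nprod[of \<epsilon> n w]]) auto

lemma nsum_linear: "linear_op (nsum \<epsilon> f U V n)"
proof -
  have "nsum \<epsilon> f U V n (x + y) = nsum \<epsilon> f U V n x + nsum \<epsilon> f U V n y" for x y
    unfolding nsum_def linear_opD(1)[OF nprod_linear] scale_right_distrib
    by (rule Sum_any.distrib[OF finite_nsum finite_nsum])
  moreover have "nsum \<epsilon> f U V n (c *s x) = c *s nsum \<epsilon> f U V n x" for c x
    unfolding nsum_def scale_Sum_any[OF finite_nsum]
    by (simp add: linear_opD[OF nprod_linear] mult.commute)
  ultimately show ?thesis by (simp add: linear_op_iff)
qed

lemma nsum_add: "nsum \<epsilon> (\<lambda>k. f k + g k) U V n w = nsum \<epsilon> f U V n w + nsum \<epsilon> g U V n w"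
  unfolding nsum_def scale_left_distrib by (rule Sum_any.distrib[OF finite_nsum finite_nsum])

lemma nsum_scale: "nsum \<epsilon> (\<lambda>k. c * f k) U V n w = c *s nsum \<epsilon> f U V n w"
  by (simp add: nsum_def scale_Sum_any[OF finite_nsum])

lemma nsum_mem:
  assumes "subspace X" "\<And>k. nprod \<epsilon> U V k (n - k) w \<in> X"
  shows "nsum \<epsilon> f U V n w \<in> X"
  unfolding nsum_def Sum_any.expand_set
  by (rule subspace_sum[OF assms(1)]) (simp add: subspace_scale[OF assms(1)] assms(2))

text \<open>For \<open>n \<noteq> h\<close> the two factors commute up to \<open>\<epsilon>\<close>,
  so either may be taken as the inner one; for large \<open>n\<close> at least one of the indices
  \<open>k\<close>, \<open>n - k\<close> is large enough for its mode to kill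
  \<open>w\<close>.\<close>

lemma nsum_smooth:
  assumes "\<And>i j w. i + j \<noteq> h \<Longrightarrow> U i (V j w) = \<epsilon> *s V j (U i w)"
  shows "smooth_modes (nsum \<epsilon> f U V)"
  unfolding smooth_modes_def
proof
  fix w
  obtain K where K: "U k w = 0" if "k \<ge> K" for k
    using smooth_U by (auto simp: smooth_modes_def eventually_at_top_linorder)
  obtain K' where K': "V k w = 0" if "k \<ge> K'" for k
    using smooth_V by (auto simp: smooth_modes_def eventually_at_top_linorder)
  \<comment> \<open>The bound forces \<open>n \<noteq> h\<close>, and \<open>n - k \<ge> K'\<close>
    whenever \<open>k < K\<close>.\<close>
  have "nsum \<epsilon> f U V n w = 0" if n: "n \<ge> \<bar>K\<bar> + \<bar>K'\<bar> + \<bar>h\<bar> + 1" for n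
  proof -
    have "nprod \<epsilon> U V k (n - k) w = 0" for k
    proof (cases "k \<ge> K")
      case True
      then show ?thesis using assms[of k "n - k" w] n by (simp add: nprod_def K UV_linear)
    next
      case False
      then have "n - k \<ge> K'" using n by linarith
      then show ?thesis
        using assms[of k "n - k" w] n by (auto simp: nprod_def K' UV_linear)
    qed
    then show ?thesis by (simp add: nsum_def)
  qed
  then show "\<forall>\<^sub>F n in at_top. nsum \<epsilon> f U V n w = 0"
    by (auto simp: eventually_at_top_linorder)
qed

text \<open>Moving \<open>D\<close> through a pair leaves at most two contractions. In the order
  \<open>U V\<close> they carry the factors \<open>a\<close> and \<open>p * b\<close>, in the order
  \<open>V U\<close> the factors \<open>\<epsilon> * q * a\<close> and
  \<open>\<epsilon> * b\<close>. The conditions on \<open>a\<close> and \<open>b\<close> make these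
  agree, so the result does not depend on the sign of the index.\<close>

lemma nsum_bracket:
  assumes D: "linear_op D"
    and DU: "\<And>i w. D (U i w) = p *s U i (D w) + (if i = i0 then a else 0) *s w"
    and DV: "\<And>j w. D (V j w) = q *s V j (D w) + (if j = j0 then b else 0) *s w"
    and a: "a = 0 \<or> \<epsilon> * q = 1" and b: "b = 0 \<or> p = \<epsilon>"
  shows "D (nsum \<epsilon> f U V n w) = (p * q) *s nsum \<epsilon> f U V n (D w)
    + (f i0 * a) *s V (n - i0) w + (f (n - j0) * b * \<epsilon>) *s U (n - j0) w"
proof -
  have *: "D (nprod \<epsilon> U V k (n - k) w) = (p * q) *s nprod \<epsilon> U V k (n - k) (D w)
      + (if k = i0 then a else 0) *s V (n - k) w + (if k = n - j0 then b * \<epsilon> else 0) *s U k w" for k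
    using a b
    by (auto simp: nprod_def linear_opD[OF D] DU DV UV_linear scale_right_distrib mult_ac)
  have "D (nsum \<epsilon> f U V n w) = Sum_any (\<lambda>k. f k *s D (nprod \<epsilon> U V k (n - k) w))"
    by (simp add: nsum_def linear_op_Sum_any[OF D finite_nsum] linear_opD[OF D])
  also have "\<dots> = Sum_any (\<lambda>k. (p * q) *s f k *s nprod \<epsilon> U V k (n - k) (D w)
      + ((if k = i0 then f i0 * a else 0) *s V (n - k) w
      + (if k = n - j0 then f (n - j0) * b * \<epsilon> else 0) *s U k w))"
    by (rule Sum_any.cong) (auto simp: * scale_right_distrib mult_ac)
  also have "\<dots> = (p * q) *s nsum \<epsilon> f U V n (D w)
    + ((f i0 * a) *s V (n - i0) w + (f (n - j0) * b * \<epsilon>) *s U (n - j0) w)"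
  proof -
    have 1: "finite {k. (p * q) *s f k *s nprod \<epsilon> U V k (n - k) (D w) \<noteq> 0}"
      by (rule finite_subset[OF _ finite_nsum[of f \<epsilon> n "D w"]]) auto
    have 2: "finite {k. (if k = i0 then f i0 * a else 0) *s V (n - k) w \<noteq> 0}"
      by (rule finite_subset[of _ "{i0}"]) (auto split: if_splits)
    have 3: "finite {k. (if k = n - j0 then f (n - j0) * b * \<epsilon> else 0) *s U k w \<noteq> 0}"
      by (rule finite_subset[of _ "{n - j0}"]) (auto split: if_splits)
    show ?thesis
      by (subst Sum_any.distrib[OF 1 finite_support_add[OF 2 3]], subst Sum_any.distrib[OF 2 3])
         (simp only: nsum_def scale_Sum_any[OF finite_nsum] Sum_any_delta_scale)
  qed
  finally show ?thesis by (simp add: add.assoc)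
qed

text \<open>
  The derivation shifts one factor past the boundary between creation and annihilation modes;
  reordering the finitely many pairs concerned produces the anomaly.
\<close>

lemma nsum_derivation:
  assumes D: "linear_op D"
    and DU: "\<And>k w. D (U k w) = U k (D w) + \<alpha> k *s U (m + k) w"
    and DV: "\<And>k w. D (V k w) = V k (D w) + \<beta> k *s V (m + k) w"
    and UV: "\<And>i j w. U i (V j w) = \<epsilon> *s V j (U i w) + (if i + j = h then \<kappa> i else 0) *s w"
  shows "D (nsum \<epsilon> f U V n w) = nsum \<epsilon> f U V n (D w)
    + nsum \<epsilon> (\<lambda>k. f (k - m) * \<alpha> (k - m) + f k * \<beta> (n - k)) U V (m + n) w
    + (if m + n = h then (\<Sum>k\<in>{-m..<0}. f k * \<alpha> k * \<kappa> (m + k)) - (\<Sum>k\<in>{0..<-m}. f k * \<alpha> k * \<kappa> (m + k))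
       else 0) *s w"
proof -
  let ?N = "nprod \<epsilon> U V"
  define g where "g k = f k * \<alpha> k * \<kappa> (m + k)" for k
  \<comment> \<open>\<open>c k\<close> is the cost of reordering. For
    \<open>k < 0 \<le> m + k\<close> the product \<open>U V\<close> must become
    \<open>\<epsilon>\<close> times \<open>V U\<close>, which adds \<open>g k\<close>; for
    \<open>m + k < 0 \<le> k\<close> the opposite exchange subtracts it. Terms in which
    \<open>D\<close> hits \<open>V\<close> keep the index of \<open>U\<close> and remain
    ordered.\<close>
  define c where "c k = (if m + n = h then (if k \<in> {-m..<0} then g k else 0)
      - (if k \<in> {0..<-m} then g k else 0) else 0)" for k
  have *: "f k *s D (?N k (n - k) w) = f k *s ?N k (n - k) (D w)
      + ((f k * \<alpha> k) *s ?N (k + m) (n - k) w + ((f k * \<beta> (n - k)) *s ?N k (m + n - k) w + c k *s w))" for k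
  proof -
    have 1: "U (m + k) (V (n - k) w) = \<epsilon> *s V (n - k) (U (m + k) w)
        + (if m + n = h then \<kappa> (m + k) else 0) *s w"
      using UV[of "m + k" "n - k" w] by (simp add: algebra_simps)
    from 1 show ?thesis
      by (auto simp: nprod_def linear_opD[OF D] DU DV UV_linear scale_right_distrib c_def g_def add_diff_eq add_ac mult_ac)
  qed
  have finc: "finite {k. c k \<noteq> 0}"
    by (rule finite_subset[of _ "{-m..<0} \<union> {0..<-m}"]) (auto simp: c_def split: if_splits)
  have 1: "finite {k. f k *s ?N k (n - k) (D w) \<noteq> 0}"
    by (rule finite_nsum)
  have 2: "finite {k. (f k * \<alpha> k) *s ?N (k + m) (n - k) w \<noteq> 0}"
  proof -
    have "{k. ?N (k + m) (n - k) w \<noteq> 0} = (\<lambda>k. k + m) -` {k. ?N k (m + n - k) w \<noteq> 0}"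
      by (auto simp: algebra_simps)
    also have "finite \<dots>"
      by (rule finite_vimageI[OF finite_nprod]) (auto simp: inj_def)
    finally show ?thesis by (rule rev_finite_subset) auto
  qed
  have 3: "finite {k. (f k * \<beta> (n - k)) *s ?N k (m + n - k) w \<noteq> 0}"
    by (rule finite_nsum[of "\<lambda>k. f k * \<beta> (n - k)"])
  have 4: "finite {k. c k *s w \<noteq> 0}"
    by (rule finite_subset[OF _ finc]) auto
  \<comment> \<open>Reindexing by \<open>m\<close> turns the shifted left index back into
    \<open>k\<close>; hence the arguments \<open>k - m\<close> in the coefficient.\<close>
  have G1: "Sum_any (\<lambda>k. (f k * \<alpha> k) *s ?N (k + m) (n - k) w)
      = nsum \<epsilon> (\<lambda>k. f (k - m) * \<alpha> (k - m)) U V (m + n) w"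
    using Sum_any_shift[of "\<lambda>k. (f (k - m) * \<alpha> (k - m)) *s ?N k (m + n - k) w" m]
    by (simp add: nsum_def algebra_simps)
  have H: "Sum_any (\<lambda>k. c k *s w) = (if m + n = h then sum g {-m..<0} - sum g {0..<-m} else 0) *s w"
  proof -
    have "Sum_any (\<lambda>k. c k *s w) = (\<Sum>k\<in>{-m..<0} \<union> {0..<-m}. c k *s w)"
      by (rule Sum_any.expand_superset) (auto simp: c_def split: if_splits)
    also have "\<dots> = (\<Sum>k\<in>{-m..<0} \<union> {0..<-m}. c k) *s w"
      by (simp add: scale_sum_left)
    also have "(\<Sum>k\<in>{-m..<0} \<union> {0..<-m}. c k) = (if m + n = h then sum g {-m..<0} - sum g {0..<-m} else 0)"
    proof (cases "m + n = h")
      case True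
      have "(\<Sum>k\<in>{-m..<0} \<union> {0..<-m}. if k \<in> {-m..<0} then g k else 0) = sum g {-m..<0}"
        by (subst sum.inter_restrict[symmetric]) (auto intro!: sum.cong)
      moreover have "(\<Sum>k\<in>{-m..<0} \<union> {0..<-m}. if k \<in> {0..<-m} then g k else 0) = sum g {0..<-m}"
        by (subst sum.inter_restrict[symmetric]) (auto intro!: sum.cong)
      ultimately show ?thesis using True by (simp only: c_def simp_thms if_True sum_subtractf)
    qed (simp add: c_def)
    finally show ?thesis .
  qed
  have "D (nsum \<epsilon> f U V n w) = Sum_any (\<lambda>k. f k *s D (?N k (n - k) w))"
    by (simp add: nsum_def linear_op_Sum_any[OF D finite_nsum] linear_opD[OF D])
  also have "\<dots> = nsum \<epsilon> f U V n (D w) + (nsum \<epsilon> (\<lambda>k. f (k - m) * \<alpha> (k - m)) U V (m + n) w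
      + (nsum \<epsilon> (\<lambda>k. f k * \<beta> (n - k)) U V (m + n) w
      + (if m + n = h then sum g {-m..<0} - sum g {0..<-m} else 0) *s w))"
    unfolding * Sum_any.distrib[OF 1 finite_support_add[OF 2 finite_support_add[OF 3 4]]]
      Sum_any.distrib[OF 2 finite_support_add[OF 3 4]] Sum_any.distrib[OF 3 4] G1 H
    by (simp only: nsum_def)
  finally show ?thesis by (simp add: nsum_add g_def add.assoc)
qed

end

section \<open>Modules over algebras with a basis\<close>

definition free_act ::
    "(complex \<Rightarrow> 'w::ab_group_add \<Rightarrow> 'w) \<Rightarrow> ('b \<Rightarrow> 'w \<Rightarrow> 'w) \<Rightarrow> ('b \<Rightarrow>\<^sub>0 complex) \<Rightarrow> 'w \<Rightarrow> 'w" where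
  "free_act scale g x w = (\<Sum>b\<in>Poly_Mapping.keys x. scale (Poly_Mapping.lookup x b) (g b w))"

context super_space
begin

sublocale operator_space scale ..

lemma free_act_superset:
  assumes "finite X" "Poly_Mapping.keys x \<subseteq> X"
  shows "free_act scale g x w = (\<Sum>b\<in>X. scale (Poly_Mapping.lookup x b) (g b w))"
  unfolding free_act_def
  by (rule sum.mono_neutral_left) (use assms in \<open>auto simp: in_keys_iff\<close>)

lemma free_act_add: "free_act scale g (x + y) w = free_act scale g x w + free_act scale g y w"
proof -
  have "finite (Poly_Mapping.keys x \<union> Poly_Mapping.keys y)" by simp
  note * = free_act_superset[OF this]
  show ?thesis
    using keys_add[of x y]
    by (subst (1 2 3) *) (auto simp: lookup_add scale_left_distrib sum.distrib)
qed

lemma free_act_vscale: "free_act scale g (vscale c x) w = scale c (free_act scale g x w)"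
  by (subst (1 2) free_act_superset[of "Poly_Mapping.keys x"])
     (auto simp: keys_vscale scale_sum_right)

lemma free_act_gen: "free_act scale g (gen b) w = g b w"
  by (simp add: free_act_def)

lemma free_act_0: "free_act scale g 0 w = 0"
  by (simp add: free_act_def)

lemma free_act_uminus: "free_act scale g (- x) w = - free_act scale g x w"
  using free_act_vscale[of g "-1" x w] by simp

lemma free_act_diff: "free_act scale g (x - y) w = free_act scale g x w - free_act scale g y w"
  using free_act_add[of g x "- y" w] by (simp add: free_act_uminus)

lemma free_act_linear:
  assumes "\<And>b. linear_op (g b)"
  shows "linear_op (free_act scale g x)"
  by (simp add: linear_op_iff free_act_def linear_opD[OF assms] scale_right_distrib sum.distrib
      scale_sum_right mult.commute)

text \<open>Both sides of the bracket axiom are bilinear in the algebra elements, and a homogeneous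
  element is a combination of basis elements of its own parity, so the Koszul sign stays constant in
  the induction and the axiom reduces to pairs of generators.\<close>

lemma lie_supermodule_free_act:
  assumes alg: "lie_superalgebra vscale (free_gr od) (bilinear_ext f)"
    and lin: "\<And>b. linear_op (g b)"
    and deg: "\<And>b q w. w \<in> gr q \<Longrightarrow> g b w \<in> gr (od b \<noteq> q)"
    and br: "\<And>i j w. free_act scale g (f i j) w
      = g i (g j w) - scale (koszul (od i) (od j)) (g j (g i w))"
  shows "lie_supermodule vscale (free_gr od) (bilinear_ext f) scale gr (free_act scale g)"
proof -
  note act = free_act_add free_act_vscale free_act_gen free_act_0
    linear_opD[OF free_act_linear[of g, OF lin]]
  interpret alg: lie_superalgebra vscale "free_gr od" "bilinear_ext f" by (rule alg)
  have "Vector_Spaces.linear vscale scale (\<lambda>x. free_act scale g x w)" for w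
    by (simp add: Vector_Spaces.linear_iff act vector_space_vscale vector_space_axioms)
  moreover have "free_act scale g x w \<in> gr (p \<noteq> q)" if "x \<in> free_gr od p" "w \<in> gr q" for x w p q
    using that
  proof (induction rule: free_gr_induct)
    case zero
    then show ?case by (simp add: act subspace_0[OF gr_subspace])
  next
    case (add u v)
    then show ?case by (simp add: act subspace_add[OF gr_subspace])
  next
    case (single b c)
    then show ?case using deg[of w q b] by (simp add: act subspace_scale[OF gr_subspace] del: vscale_single)
  qed
  moreover have "free_act scale g (bilinear_ext f x y) w
      = free_act scale g x (free_act scale g y w)
        - scale (koszul p q) (free_act scale g y (free_act scale g x w))"
    if "x \<in> free_gr od p" "y \<in> free_gr od q" for x y w p q
    using that
  proof (induction rule: free_gr_induct)
    case zero
    then show ?case by (simp add: act)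
  next
    case (add u v)
    then show ?case by (simp add: act bilinear_ext_linear scale_right_distrib)
  next
    case (single b c)
    from single(2,1) show ?case
    proof (induction rule: free_gr_induct)
      case zero
      then show ?case by (simp add: act)
    next
      case (add u v)
      then show ?case by (simp add: act bilinear_ext_linear scale_right_distrib)
    next
      case (single b' c')
      have "bilinear_ext f (vscale c (gen b)) (vscale c' (gen b')) = vscale (c * c') (f b b')"
        by simp
      with single show ?case
        by (simp add: act br linear_opD[OF lin] scale_right_diff_distrib mult_ac del: vscale_single)
    qed
  qed
  ultimately show ?thesis
    by (intro lie_supermodule.intro lie_supermodule_axioms.intro alg super_space_axioms
        free_act_linear lin)
qed

end
section \<open>The free field realisation\<close>

lemma sum_int_upto: "(\<Sum>k\<in>{0..<int m}. f k) = (\<Sum>k<m. f (int k))"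
  by (rule sum.reindex_bij_witness[of _ int nat]) auto

lemma sum_int_downto: "(\<Sum>k\<in>{- int m..<0}. f k) = (\<Sum>k<m. f (- int m + int k))"
  by (rule sum.reindex_bij_witness[of _ "\<lambda>k. - int m + int k" "\<lambda>k. nat (k + int m)"]) auto

text \<open>This is the reordering sum of \<open>nsum_derivation\<close> for \<open>f = 1\<close>,
  \<open>\<alpha> k = - k\<close> and \<open>\<kappa> i = i\<close>. The sign of \<open>m\<close>
  decides which range can be nonempty; up to sign it yields the sum of
  \<open>k * (\<bar>m\<bar> - k)\<close> over \<open>k < \<bar>m\<bar>\<close>.\<close>

lemma sum_boson_anomaly:
  "(\<Sum>k\<in>{-m..<0}. - of_int k * of_int (m + k)) - (\<Sum>k\<in>{0..<-m}. - of_int k * of_int (m + k))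
    = ((of_int m ^ 3 - of_int m) / 6 :: complex)"
proof -
  \<comment> \<open>\<open>q\<close> must stay fixed while \<open>p\<close> grows in the induction;
    both uses then set them equal.\<close>
  have *: "(\<Sum>k<p. of_nat k * (of_nat q - of_nat k) :: complex)
      = of_nat q * of_nat p * (of_nat p - 1) / 2 - of_nat p * (of_nat p - 1) * (2 * of_nat p - 1) / 6" for p q :: nat
    by (induction p) (auto simp: field_simps power2_eq_square)
  show ?thesis
  proof (cases m)
    case (nonneg p)
    have "(\<Sum>k\<in>{-m..<0}. - of_int k * of_int (m + k)) = (\<Sum>k<p. of_nat k * (of_nat p - of_nat k) :: complex)"
      unfolding nonneg sum_int_downto by (rule sum.cong) (auto simp: algebra_simps)
    moreover have "{0..<-m} = {}" using nonneg by auto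
    ultimately show ?thesis
      unfolding * by (simp only:) (simp add: nonneg field_simps power3_eq_cube)
  next
    case (neg p)
    define q where "q = Suc p"
    have m: "m = - int q" using neg by (simp add: q_def)
    have "(\<Sum>k\<in>{0..<-m}. - of_int k * of_int (m + k)) = (\<Sum>k<q. of_nat k * (of_nat q - of_nat k) :: complex)"
      unfolding m minus_minus sum_int_upto by (rule sum.cong) (auto simp: algebra_simps)
    moreover have "{-m..<0} = {}" using m by auto
    ultimately show ?thesis
      unfolding * by (simp only:) (simp add: m field_simps power3_eq_cube)
  qed
qed

text \<open>The same reordering sum for a pair of fermions:
  \<open>\<alpha> k = - (m / 2 + half k)\<close>, \<open>\<kappa> = 1\<close>, and
  \<open>f k = - (k + 1) / 2\<close>, the two minus signs having cancelled.\<close>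

lemma sum_fermion_anomaly:
  "(\<Sum>k\<in>{-m..<0}. (of_int k + 1) / 2 * (of_int m / 2 + half k))
    - (\<Sum>k\<in>{0..<-m}. (of_int k + 1) / 2 * (of_int m / 2 + half k))
    = (of_int m ^ 3 - of_int m) / 24"
proof -
  \<comment> \<open>\<open>x\<close> is the start of the range and \<open>y\<close> stands for
    \<open>m / 2\<close>. Both must be independent of \<open>p\<close> in the induction, although
    they become \<open>- p\<close> and \<open>p / 2\<close> in the first use.\<close>
  have *: "(\<Sum>k<p. (x + of_nat k + 1) / 2 * (y + (x + of_nat k + 1 / 2)) :: complex)
      = of_nat p * (x + 1) * (y + x + 1/2) / 2 + (2 * x + y + 3/2) * of_nat p * (of_nat p - 1) / 4
        + of_nat p * (of_nat p - 1) * (2 * of_nat p - 1) / 12" for p :: nat and x y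
  proof (induction p)
    case (Suc p)
    show ?case unfolding sum.lessThan_Suc Suc.IH of_nat_Suc by (simp add: field_simps)
  qed simp
  show ?thesis
  proof (cases m)
    case (nonneg p)
    have "(\<Sum>k\<in>{-m..<0}. (of_int k + 1) / 2 * (of_int m / 2 + half k))
        = (\<Sum>k<p. (- of_nat p + of_nat k + 1) / 2 * (of_nat p / 2 + (- of_nat p + of_nat k + 1 / 2)))"
      unfolding nonneg sum_int_downto by (rule sum.cong) (auto simp: half_def)
    moreover have "{0..<-m} = {}" using nonneg by auto
    ultimately show ?thesis
      unfolding * by (simp only:) (simp add: nonneg field_simps power3_eq_cube)
  next
    case (neg p)
    define q where "q = Suc p"
    have m: "m = - int q" using neg by (simp add: q_def)
    have "(\<Sum>k\<in>{0..<-m}. (of_int k + 1) / 2 * (of_int m / 2 + half k))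
        = (\<Sum>k<q. (0 + of_nat k + 1) / 2 * (- of_nat q / 2 + (0 + of_nat k + 1 / 2)))"
      unfolding m minus_minus sum_int_upto by (rule sum.cong) (auto simp: half_def)
    moreover have "{-m..<0} = {}" using m by auto
    ultimately show ?thesis
      unfolding * by (simp only:) (simp add: m field_simps power3_eq_cube)
  qed
qed

section \<open>Level one modes and their quadratic operators\<close>

text \<open>The module seen only through its generators, with the central element replaced by 1.
  Since \<open>C k\<close> stands for the mode with index \<open>k + 1/2\<close>, opposite indices
  have codes adding up to -1.\<close>

locale heisenberg_clifford_modes = super_space scale gr
  for scale :: "complex \<Rightarrow> 'w::ab_group_add \<Rightarrow> 'w" (infixr \<open>*s\<close> 75) and gr :: "bool \<Rightarrow> 'w set" +
  fixes A B C :: "int \<Rightarrow> 'w \<Rightarrow> 'w"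
  assumes linear_A: "linear_op (A k)" and linear_B: "linear_op (B k)" and linear_C: "linear_op (C k)"
    and smooth_A: "smooth_modes A" and smooth_B: "smooth_modes B"
    and smooth_C: "smooth_modes C"
    and gr_A: "w \<in> gr q \<Longrightarrow> A k w \<in> gr q" and gr_B: "w \<in> gr q \<Longrightarrow> B k w \<in> gr q"
    and gr_C: "w \<in> gr q \<Longrightarrow> C k w \<in> gr (\<not> q)"
    and AA: "A j (A k w) = A k (A j w)" and BB: "B j (B k w) = B k (B j w)"
    and AB: "A j (B k w) = B k (A j w) + (if j + k = 0 then of_int j else 0) *s w"
    and AC: "A j (C k w) = C k (A j w)" and BC: "B j (C k w) = C k (B j w)"
    and CC: "C j (C k w) = - C k (C j w) + (if j + k = -1 then 1 else 0) *s w"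
begin

lemmas ABC_linear = linear_opD[OF linear_A] linear_opD[OF linear_B] linear_opD[OF linear_C]

sublocale AB: mode_pair scale A B
  by (intro mode_pair.intro mode_pair_axioms.intro operator_space_axioms linear_A linear_B smooth_A smooth_B)

sublocale BB: mode_pair scale B B
  by (intro mode_pair.intro mode_pair_axioms.intro operator_space_axioms linear_B smooth_B)

sublocale CB: mode_pair scale C B
  by (intro mode_pair.intro mode_pair_axioms.intro operator_space_axioms linear_B linear_C smooth_B smooth_C)

sublocale CC: mode_pair scale C C
  by (intro mode_pair.intro mode_pair_axioms.intro operator_space_axioms linear_C smooth_C)

text \<open>
  \<open>cc_coeff k\<close> is $-(s + 1/2)/2$ for $s = k + 1/2$. In \<open>TC n\<close> the modes of $c_s c_{n-s}$ carry the codes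
  \<open>k\<close> and \<open>n - 1 - k\<close>, whence the index \<open>n - 1\<close>.
\<close>

definition cc_coeff :: "int \<Rightarrow> complex" where
  "cc_coeff k = - (of_int k + 1) / 2"

definition TA :: "int \<Rightarrow> 'w \<Rightarrow> 'w" where
  "TA n = nsum 1 (\<lambda>_. 1) A B n"

definition TC :: "int \<Rightarrow> 'w \<Rightarrow> 'w" where
  "TC n = nsum (-1) cc_coeff C C (n - 1)"

definition T :: "int \<Rightarrow> 'w \<Rightarrow> 'w" where
  "T n w = TA n w + TC n w"

definition P :: "int \<Rightarrow> 'w \<Rightarrow> 'w" where
  "P n = nsum 1 (\<lambda>_. 1 / 2) B B n"

text \<open>With \<open>C\<close> on the left the summation index is that of the fermion; the codes
  satisfy \<open>k + (j - k) = j\<close> because only one of the two indices is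
  half-integral.\<close>

definition S :: "int \<Rightarrow> 'w \<Rightarrow> 'w" where
  "S j = nsum 1 (\<lambda>_. 1) C B j"

section \<open>Brackets of the quadratic operators with single modes\<close>

lemma linear_TA: "linear_op (TA n)" and linear_TC: "linear_op (TC n)"
  and linear_P: "linear_op (P n)" and linear_S: "linear_op (S j)"
  by (simp_all add: TA_def TC_def P_def S_def AB.nsum_linear CC.nsum_linear BB.nsum_linear CB.nsum_linear)

lemma linear_T: "linear_op (T n)"
  by (simp add: linear_op_iff T_def linear_opD[OF linear_TA] linear_opD[OF linear_TC]
      scale_right_distrib add_ac)

lemmas T_linear = linear_opD[OF linear_T] and P_linear = linear_opD[OF linear_P]
  and S_linear = linear_opD[OF linear_S]

text \<open>The single mode takes the role of \<open>D\<close> in \<open>nsum_bracket\<close>. It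
  contracts only with \<open>B (- k)\<close>, whose partner in the sum is \<open>A (m + k)\<close>;
  moving terms across then gives the bracket from the other side.\<close>

lemma TA_A: "TA m (A k w) = A k (TA m w) + (- of_int k) *s A (m + k) w"
proof -
  \<comment> \<open>A vanishing contraction is given the dummy position 0 and coefficient 0 to fit
    the form required by \<open>nsum_bracket\<close>; the same device recurs below.\<close>
  have 1: "A k (A i w) = 1 *s A i (A k w) + (if i = 0 then 0 else 0) *s w" for i w
    using AA[of k i w] by simp
  have 2: "A k (B j w) = 1 *s B j (A k w) + (if j = -k then of_int k else 0) *s w" for j w
    using AB[of k j w] by (auto simp: add_eq_0_iff)
  show ?thesis
    using AB.nsum_bracket[OF linear_A 1 2, of 1 "\<lambda>_. 1" m w] by (simp add: TA_def)
qed

lemma TA_B: "TA m (B k w) = B k (TA m w) + (- of_int k) *s B (m + k) w"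
proof -
  have 1: "B k (A i w) = 1 *s A i (B k w) + (if i = -k then of_int k else 0) *s w" for i w
    using AB[of i k w] by (auto simp: add_eq_0_iff2)
  have 2: "B k (B j w) = 1 *s B j (B k w) + (if j = 0 then 0 else 0) *s w" for j w
    using BB[of k j w] by simp
  show ?thesis
    using AB.nsum_bracket[OF linear_B 1 2, of 1 "\<lambda>_. 1" m w] by (simp add: TA_def)
qed

lemma TA_C: "TA m (C k w) = C k (TA m w)"
proof -
  have 1: "C k (A i w) = 1 *s A i (C k w) + (if i = 0 then 0 else 0) *s w" for i w
    using AC[of i k w] by simp
  have 2: "C k (B j w) = 1 *s B j (C k w) + (if j = 0 then 0 else 0) *s w" for j w
    using BC[of j k w] by simp
  show ?thesis
    using AB.nsum_bracket[OF linear_C 1 2, of 1 "\<lambda>_. 1" m w] by (simp add: TA_def)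
qed

lemma TC_A: "TC m (A k w) = A k (TC m w)"
proof -
  have 1: "A k (C i w) = 1 *s C i (A k w) + (if i = 0 then 0 else 0) *s w" for i w
    using AC[of k i w] by simp
  show ?thesis
    using CC.nsum_bracket[OF linear_A 1 1, of "-1" cc_coeff "m - 1" w] by (simp add: TC_def)
qed

lemma TC_B: "TC m (B k w) = B k (TC m w)"
proof -
  have 1: "B k (C i w) = 1 *s C i (B k w) + (if i = 0 then 0 else 0) *s w" for i w
    using BC[of k i w] by simp
  show ?thesis
    using CC.nsum_bracket[OF linear_B 1 1, of "-1" cc_coeff "m - 1" w] by (simp add: TC_def)
qed

text \<open>An odd mode contracts with both factors, with opposite signs, so the bracket is a
  difference of two values of \<open>cc_coeff\<close>.\<close>

lemma TC_C: "TC m (C k w) = C k (TC m w) + (- (of_int m / 2 + half k)) *s C (m + k) w"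
proof -
  have 1: "C k (C i w) = (-1) *s C i (C k w) + (if i = - k - 1 then 1 else 0) *s w" for i w
    using CC[of k i w] by (auto simp: algebra_simps)
  have "C k (TC m w) = TC m (C k w)
      + (cc_coeff (- k - 1) *s C (m + k) w + (- cc_coeff (m + k)) *s C (m + k) w)"
    using CC.nsum_bracket[OF linear_C 1 1, of "-1" cc_coeff "m - 1" w]
    by (simp add: TC_def add_ac)
  also have "cc_coeff (- k - 1) *s C (m + k) w + (- cc_coeff (m + k)) *s C (m + k) w
      = (of_int m / 2 + half k) *s C (m + k) w"
    unfolding scale_left_distrib[symmetric]
    by (rule arg_cong[of _ _ "\<lambda>c. c *s _"]) (simp add: cc_coeff_def half_def field_simps)
  finally show ?thesis by (simp only: scale_minus_left) simp
qed

lemma T_A: "T m (A k w) = A k (T m w) + (- of_int k) *s A (m + k) w"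
  by (simp add: T_def TA_A TC_A ABC_linear)

lemma T_B: "T m (B k w) = B k (T m w) + (- of_int k) *s B (m + k) w"
  by (simp add: T_def TA_B TC_B ABC_linear)

lemma T_C: "T m (C k w) = C k (T m w) + (- (of_int m / 2 + half k)) *s C (m + k) w"
  by (simp add: T_def TA_C TC_C ABC_linear)

section \<open>Brackets of \<open>T\<close> with quadratic operators\<close>

lemma nsum_CC_symmetric:
  assumes "\<And>k. f (n - k) = f k"
  shows "nsum (-1) f C C n w = 0"
proof -
  \<comment> \<open>The swap leaves no scalar: two codes that are both negative or both nonnegative
    never add up to -1, and for mixed signs the ordering puts the same mode inside on both sides.
    Hence a symmetric sum equals its own negative.\<close>
  have swap: "nprod (-1) C C (n - k) k w = - nprod (-1) C C k (n - k) w" for k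
    using CC[of k "n - k" w] CC[of "n - k" k w] by (auto simp: nprod_def)
  have "nsum (-1) f C C n w = Sum_any (\<lambda>k. f (n - k) *s nprod (-1) C C (n - k) k w)"
    unfolding nsum_def
    by (subst Sum_any_reflect[of "\<lambda>k. f k *s nprod (-1) C C k (n - k) w" n, symmetric]) simp
  also have "\<dots> = Sum_any (\<lambda>k. (-1) *s (f k *s nprod (-1) C C k (n - k) w))"
    by (rule Sum_any.cong) (simp add: assms swap)
  also have "\<dots> = - nsum (-1) f C C n w"
    by (subst scale_Sum_any[symmetric, OF CC.finite_nsum]) (simp add: nsum_def)
  finally have "nsum (-1) f C C n w + nsum (-1) f C C n w = 0"
    by (simp add: eq_neg_iff_add_eq_0)
  then have "2 *s nsum (-1) f C C n w = 0"
    using scale_left_distrib[of 1 1 "nsum (-1) f C C n w"] by simp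
  then show ?thesis by simp
qed

text \<open>Here \<open>T m\<close> is the derivation. The two shifted contributions carry
  \<open>- (k - m)\<close> and \<open>- (n - k)\<close>, whose sum no longer depends on
  \<open>k\<close>.\<close>

lemma T_TA: "T m (TA n w) = TA n (T m w) + of_int (m - n) *s TA (m + n) w + (2 * central_term m n) *s w"
proof -
  have AB': "A i (B j w) = 1 *s B j (A i w) + (if i + j = 0 then of_int i else 0) *s w" for i j w
    using AB[of i j w] by simp
  have coeff: "- of_int (k - m) + - of_int (n - k) = (of_int (m - n) :: complex)" for k
    by simp
  have "T m (TA n w) = TA n (T m w) + of_int (m - n) *s TA (m + n) w
      + (if m + n = 0 then (of_int m ^ 3 - of_int m) / 6 else 0) *s w"
    unfolding TA_def AB.nsum_scale[symmetric]
      AB.nsum_derivation[where m = m and f = "\<lambda>_. 1" and n = n and w = w, OF linear_T T_A T_B AB']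
      mult_1_left mult_1_right coeff
      sum_boson_anomaly ..
  then show ?thesis by (simp add: central_term_def)
qed

lemma T_TC: "T m (TC n w) = TC n (T m w) + of_int (m - n) *s TC (m + n) w + (central_term m n / 2) *s w"
proof -
  \<comment> \<open>Here \<open>\<kappa>\<close> is constantly 1 and \<open>h = -1\<close>; with the
    index \<open>n - 1\<close> of \<open>TC n\<close>, the anomaly condition becomes
    \<open>m + n = 0\<close>.\<close>
  have CC': "C i (C j w) = (-1) *s C j (C i w) + (if i + j = -1 then 1 else 0) *s w" for i j w
    using CC[of i j w] by simp
  have coeff: "cc_coeff (k - m) * - (of_int m / 2 + half (k - m))
      + cc_coeff k * - (of_int m / 2 + half (n - 1 - k))
      = of_int (m - n) * cc_coeff k + of_int m * (of_int m + 1) / 4" for k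
    by (simp add: cc_coeff_def half_def field_simps)
  have anomaly: "cc_coeff k * - (of_int m / 2 + half k) * 1 = (of_int k + 1) / 2 * (of_int m / 2 + half k)" for k
    by (simp add: cc_coeff_def field_simps)
  have shift: "m + (n - 1) = m + n - 1" by simp
  \<comment> \<open>The coefficient is only determined up to functions symmetric under \<open>k \<mapsto> m + n - 1 - k\<close>.\<close>
  have sym: "nsum (-1) (\<lambda>k. of_int m * (of_int m + 1) / 4) C C (m + n - 1) w = 0"
    by (rule nsum_CC_symmetric) simp
  have "T m (TC n w) = TC n (T m w) + of_int (m - n) *s TC (m + n) w
      + (if m + n - 1 = -1 then (of_int m ^ 3 - of_int m) / 24 else 0) *s w"
    unfolding TC_def CC.nsum_scale[symmetric]
      CC.nsum_derivation[where m = m and f = cc_coeff and n = "n - 1" and w = w, OF linear_T T_C T_C CC'] coeff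
      anomaly sum_fermion_anomaly shift CC.nsum_add sym by simp
  then show ?thesis by (simp add: central_term_def)
qed

lemma T_T: "T m (T n w) = T n (T m w) + of_int (m - n) *s T (m + n) w + (5 / 2 * central_term m n) *s w"
proof -
  have "T m (T n w) = T n (T m w) + of_int (m - n) *s T (m + n) w
      + ((2 * central_term m n) *s w + (central_term m n / 2) *s w)"
    by (simp add: T_def[of n] T_def[of "m + n"] T_linear T_TA T_TC scale_right_distrib)
  then show ?thesis by (simp flip: scale_left_distrib)
qed

text \<open>Since the \<open>B\<close> modes commute, \<open>\<kappa> = 0\<close> and reordering
  produces no anomaly.\<close>

lemma T_P: "T m (P n w) = P n (T m w) + of_int (m - n) *s P (m + n) w"
proof -
  have BB': "B i (B j w) = 1 *s B j (B i w) + (if i + j = 0 then 0 else 0) *s w" for i j w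
    using BB[of i j w] by simp
  have coeff: "(1 / 2 * (- of_int (k - m)) + 1 / 2 * (- of_int (n - k)) :: complex) = of_int (m - n) * (1 / 2)" for k
    by (simp add: field_simps)
  show ?thesis
    unfolding P_def BB.nsum_scale[symmetric]
      BB.nsum_derivation[where m = m and f = "\<lambda>_. 1 / 2" and n = n and w = w, OF linear_T T_B T_B BB'] coeff by simp
qed

lemma T_S: "T m (S j w) = S j (T m w) + (of_int m / 2 - half j) *s S (m + j) w"
proof -
  have CB': "C i (B j w) = 1 *s B j (C i w) + (if i + j = 0 then 0 else 0) *s w" for i j w
    using BC[of j i w] by simp
  have coeff: "1 * - (of_int m / 2 + half (k - m)) + 1 * (- of_int (j - k))
      = (of_int m / 2 - half j) * 1" for k
    by (simp add: half_def field_simps)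
  show ?thesis
    unfolding S_def CB.nsum_scale[symmetric]
      CB.nsum_derivation[where m = m and f = "\<lambda>_. 1" and n = j and w = w, OF linear_T T_C T_B CB'] coeff by simp
qed

section \<open>Brackets of \<open>P\<close> and \<open>S\<close> with modes and with each
  other\<close>

lemma A_P: "A k (P n w) = P n (A k w) + of_int k *s B (k + n) w"
proof -
  have 1: "A k (B j w) = 1 *s B j (A k w) + (if j = -k then of_int k else 0) *s w" for j w
    using AB[of k j w] by (auto simp: add_eq_0_iff)
  have "A k (P n w) = P n (A k w) + ((of_int k / 2) *s B (k + n) w + (of_int k / 2) *s B (k + n) w)"
    using BB.nsum_bracket[OF linear_A 1 1, of 1 "\<lambda>_. 1 / 2" n w] by (simp add: P_def add_ac)
  then show ?thesis by (simp flip: scale_left_distrib)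
qed

lemma B_P: "B k (P n w) = P n (B k w)"
proof -
  have 1: "B k (B j w) = 1 *s B j (B k w) + (if j = 0 then 0 else 0) *s w" for j w
    using BB[of k j w] by simp
  show ?thesis
    using BB.nsum_bracket[OF linear_B 1 1, of 1 "\<lambda>_. 1 / 2" n w] by (simp add: P_def)
qed

lemma C_P: "C k (P n w) = P n (C k w)"
proof -
  have 1: "C k (B j w) = 1 *s B j (C k w) + (if j = 0 then 0 else 0) *s w" for j w
    using BC[of j k w] by simp
  show ?thesis
    using BB.nsum_bracket[OF linear_C 1 1, of 1 "\<lambda>_. 1 / 2" n w] by (simp add: P_def)
qed

lemma A_S: "A k (S j w) = S j (A k w) + of_int k *s C (k + j) w"
proof -
  have 1: "A k (C i w) = 1 *s C i (A k w) + (if i = 0 then 0 else 0) *s w" for i w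
    using AC[of k i w] by simp
  have 2: "A k (B j w) = 1 *s B j (A k w) + (if j = -k then of_int k else 0) *s w" for j w
    using AB[of k j w] by (auto simp: add_eq_0_iff)
  show ?thesis
    using CB.nsum_bracket[OF linear_A 1 2, of 1 "\<lambda>_. 1" j w] by (simp add: S_def add_ac)
qed

lemma B_S: "B k (S j w) = S j (B k w)"
proof -
  have 1: "B k (C i w) = 1 *s C i (B k w) + (if i = 0 then 0 else 0) *s w" for i w
    using BC[of k i w] by simp
  have 2: "B k (B j w) = 1 *s B j (B k w) + (if j = 0 then 0 else 0) *s w" for j w
    using BB[of k j w] by simp
  show ?thesis
    using CB.nsum_bracket[OF linear_B 1 2, of 1 "\<lambda>_. 1" j w] by (simp add: S_def)
qed

lemma C_S: "C j (S k w) = - S k (C j w) + B (j + k + 1) w"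
proof -
  have 1: "C j (C i w) = (-1) *s C i (C j w) + (if i = - j - 1 then 1 else 0) *s w" for i w
    using CC[of j i w] by (auto simp: algebra_simps)
  have 2: "C j (B i w) = 1 *s B i (C j w) + (if i = 0 then 0 else 0) *s w" for i w
    using BC[of i j w] by simp
  show ?thesis
    using CB.nsum_bracket[OF linear_C 1 2, of 1 "\<lambda>_. 1" k w] by (simp add: S_def algebra_simps)
qed

text \<open>\<open>P m\<close> commutes with every \<open>B\<close> mode, so it can itself serve as
  \<open>D\<close> without contractions.\<close>

lemma P_P: "P m (P n w) = P n (P m w)"
proof -
  have 1: "P m (B j w) = 1 *s B j (P m w) + (if j = 0 then 0 else 0) *s w" for j w
    by (simp add: B_P)
  show ?thesis
    using BB.nsum_bracket[OF linear_P 1 1, of 1 "\<lambda>_. 1 / 2" n w] by (simp add: P_def[of n])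
qed

lemma P_S: "P m (S j w) = S j (P m w)"
proof -
  have 1: "P m (B j w) = 1 *s B j (P m w) + (if j = 0 then 0 else 0) *s w" for j w
    by (simp add: B_P)
  have 2: "P m (C j w) = 1 *s C j (P m w) + (if j = 0 then 0 else 0) *s w" for j w
    by (simp add: C_P)
  show ?thesis
    using CB.nsum_bracket[OF linear_P 2 1, of 1 "\<lambda>_. 1" j w] by (simp add: S_def)
qed

lemma nprod_BB: "nprod 1 B B i j w = B i (B j w)"
  by (simp add: nprod_def BB[of j i])

lemma nprod_CB: "nprod 1 C B i j w = B j (C i w)"
  by (simp add: nprod_def BC)

text \<open>\<open>S j\<close> turns a mode of \<open>C\<close> into a mode of \<open>B\<close>,
  which is neither a scalar nor a shift within one field, so the earlier bracket lemmas do not fit.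
  The terms of \<open>S k\<close> are treated one by one, and the resulting products of
  \<open>B\<close> modes add up to twice \<open>P\<close>.\<close>

lemma S_S: "S j (S k w) = - S k (S j w) + 2 *s P (j + k + 1) w"
proof -
  let ?n = "j + k + 1"
  have *: "S j (nprod 1 C B p (k - p) w)
      = (-1) *s nprod 1 C B p (k - p) (S j w) + nprod 1 B B (p + (j + 1)) (?n - (p + (j + 1))) w" for p
  proof -
    have "S j (C p w) = B (p + (j + 1)) w - C p (S j w)"
      using C_S[of p j w] by (simp add: algebra_simps)
    then show ?thesis
      using BB[of "p + (j + 1)" "k - p" w] by (simp add: nprod_CB nprod_BB ABC_linear flip: B_S)
  qed
  have 1: "finite {p. (-1) *s nprod 1 C B p (k - p) (S j w) \<noteq> 0}"
    using CB.finite_nprod[of 1 k "S j w"] by simp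
  have 2: "finite {p. nprod 1 B B (p + (j + 1)) (?n - (p + (j + 1))) w \<noteq> 0}"
  proof -
    have "{p. nprod 1 B B (p + (j + 1)) (?n - (p + (j + 1))) w \<noteq> 0}
        = (\<lambda>p. p + (j + 1)) -` {p. nprod 1 B B p (?n - p) w \<noteq> 0}" by auto
    also have "finite \<dots>"
      by (rule finite_vimageI[OF BB.finite_nprod]) (auto simp: inj_def)
    finally show ?thesis .
  qed
  have "S j (S k w) = Sum_any (\<lambda>p. S j (nprod 1 C B p (k - p) w))"
    by (simp add: S_def[of k] nsum_def linear_op_Sum_any[OF linear_S CB.finite_nprod])
  also have "\<dots> = Sum_any (\<lambda>p. (-1) *s nprod 1 C B p (k - p) (S j w))
      + Sum_any (\<lambda>p. nprod 1 B B (p + (j + 1)) (?n - (p + (j + 1))) w)"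
    unfolding * by (rule Sum_any.distrib[OF 1 2])
  also have "Sum_any (\<lambda>p. (-1) *s nprod 1 C B p (k - p) (S j w)) = (-1) *s S k (S j w)"
    by (subst scale_Sum_any[OF CB.finite_nprod, symmetric]) (simp add: S_def[of k] nsum_def)
  also have "Sum_any (\<lambda>p. nprod 1 B B (p + (j + 1)) (?n - (p + (j + 1))) w)
      = Sum_any (\<lambda>p. nprod 1 B B p (?n - p) w)"
    by (rule Sum_any_shift)
  also have "\<dots> = 2 *s P ?n w"
    using BB.nsum_scale[of 1 2 "\<lambda>_. 1 / 2" ?n w] by (simp add: P_def nsum_def)
  finally show ?thesis by simp
qed

section \<open>The operators with their \<rho>-terms\<close>

definition L :: "complex \<Rightarrow> int \<Rightarrow> 'w \<Rightarrow> 'w" where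
  "L \<rho> n w = T n w - (of_int (n + 1) * \<rho>) *s A n w"

definition M :: "complex \<Rightarrow> int \<Rightarrow> 'w \<Rightarrow> 'w" where
  "M \<rho> n w = P n w - (of_int (n + 1) * \<rho>) *s B n w"

definition Q :: "complex \<Rightarrow> int \<Rightarrow> 'w \<Rightarrow> 'w" where
  "Q \<rho> j w = S j w - (2 * (half j + 1 / 2) * \<rho>) *s C j w"

lemma linear_L: "linear_op (L \<rho> n)" and linear_M: "linear_op (M \<rho> n)" and linear_Q: "linear_op (Q \<rho> j)"
  by (simp_all add: linear_op_iff L_def M_def Q_def T_linear P_linear S_linear ABC_linear
      scale_right_distrib scale_right_diff_distrib mult.commute)

lemma scale_mult_2: "(a * (b * 2)) *s v = (a * b) *s v + (a * b) *s v"
  by (simp flip: scale_left_distrib)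

lemma L_L: "L \<rho> m (L \<rho> n w) - L \<rho> n (L \<rho> m w)
    = of_int (m - n) *s L \<rho> (m + n) w + (5 / 2 * central_term m n) *s w"
  by (simp add: L_def T_linear ABC_linear T_A T_T[of m n] AA[of m n] algebra_simps)

lemma L_M: "L \<rho> m (M \<rho> n w) - M \<rho> n (L \<rho> m w)
    = of_int (m - n) *s M \<rho> (m + n) w + (- 12 * \<rho>\<^sup>2 * central_term m n) *s w"
proof (cases "m + n = 0")
  case True
  \<comment> \<open>The scalar comes from the two linear terms alone:
    \<open>(m + 1) * (n + 1) * m\<close> at \<open>n = - m\<close> equals \<open>m - m ^ 3\<close>,
    times the square of \<rho>.\<close>
  then have n: "n = - m" by simp
  have "- 12 * \<rho>\<^sup>2 * central_term m n = \<rho> * \<rho> * of_int m - \<rho> * \<rho> * (of_int m * of_int m * of_int m)"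
    by (simp add: central_term_def n power2_eq_square power3_eq_cube field_simps)
  then show ?thesis
    by (simp only:) (simp add: L_def M_def T_linear P_linear ABC_linear T_B T_P A_P AB n scale_mult_2 algebra_simps)
next
  case False
  then show ?thesis
    by (simp add: L_def M_def T_linear P_linear ABC_linear T_B T_P A_P AB central_term_def algebra_simps)
qed

lemma L_Q: "L \<rho> m (Q \<rho> j w) - Q \<rho> j (L \<rho> m w) = (of_int m / 2 - half j) *s Q \<rho> (m + j) w"
proof -
  \<comment> \<open>The abbreviations keep the scalars opaque while the operators are rearranged;
    the polynomial identity between them is checked separately.\<close>
  define x y h where "x = of_int (m + 1) * \<rho>" and "y = 2 * (half j + 1 / 2) * \<rho>" and "h = of_int m / 2 + half j"
  have TC: "T m (C j w) = C j (T m w) + (- h) *s C (m + j) w"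
    unfolding T_C h_def ..
  have "L \<rho> m (Q \<rho> j w) - Q \<rho> j (L \<rho> m w)
      = (of_int m / 2 - half j) *s S (m + j) w - (x * of_int m - y * h) *s C (m + j) w"
    unfolding L_def Q_def x_def[symmetric] y_def[symmetric]
    by (simp add: T_linear S_linear ABC_linear TC T_S A_S AC algebra_simps)
  also have "x * of_int m - y * h = (of_int m / 2 - half j) * (2 * (half (m + j) + 1 / 2) * \<rho>)"
    by (simp add: x_def y_def h_def half_def field_simps)
  finally show ?thesis
    unfolding Q_def by (simp only: scale_right_diff_distrib scale_scale)
qed

text \<open>The mixed terms contract to the linear part of \<open>M\<close>, and the product of the
  two linear terms gives the central charge through the anticommutator of the \<open>C\<close>
  modes.\<close>

lemma Q_Q: "Q \<rho> j (Q \<rho> k w) + Q \<rho> k (Q \<rho> j w)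
    = 2 *s M \<rho> (j + k + 1) w + (- 12 * \<rho>\<^sup>2 * central_term_odd j k) *s w"
proof -
  define x y where "x = 2 * (half j + 1 / 2) * \<rho>" and "y = 2 * (half k + 1 / 2) * \<rho>"
  have "Q \<rho> j (Q \<rho> k w) + Q \<rho> k (Q \<rho> j w)
      = 2 *s P (j + k + 1) w - (x + y) *s B (j + k + 1) w + (x * y * (if j + k = -1 then 1 else 0)) *s w"
    unfolding Q_def x_def[symmetric] y_def[symmetric]
    by (simp add: S_linear ABC_linear S_S[of j k] C_S CC[of j k] algebra_simps)
  also have "x + y = 2 * (of_int (j + k + 1 + 1) * \<rho>)"
    by (simp add: x_def y_def half_def algebra_simps)
  also have "x * y * (if j + k = -1 then 1 else 0) = - 12 * \<rho>\<^sup>2 * central_term_odd j k"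
  proof (cases "j + k = -1")
    case True
    then have k: "k = - 1 - j" by simp
    show ?thesis
      by (simp add: x_def y_def central_term_odd_def half_def k power2_eq_square field_simps)
  next
    case False
    then have "j + k + 1 \<noteq> 0" by linarith
    with False show ?thesis by (simp add: central_term_odd_def)
  qed
  finally show ?thesis
    unfolding M_def by (simp only: scale_right_diff_distrib scale_scale)
qed

lemma M_M: "M \<rho> m (M \<rho> n w) = M \<rho> n (M \<rho> m w)"
  by (simp add: M_def P_linear ABC_linear P_P[of m n] B_P BB[of m n] algebra_simps)

lemma M_Q: "M \<rho> m (Q \<rho> j w) = Q \<rho> j (M \<rho> m w)"
  by (simp add: M_def Q_def P_linear S_linear ABC_linear P_S B_S C_P BC algebra_simps)

section \<open>Parity and smoothness of the operators\<close>

lemma gr_T: "w \<in> gr q \<Longrightarrow> T n w \<in> gr q"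
proof -
  assume w: "w \<in> gr q"
  have "C i (C j w) \<in> gr q" for i j
    using gr_C[OF gr_C[OF w]] by simp
  then show ?thesis
    unfolding T_def TA_def TC_def
    by (intro subspace_add AB.nsum_mem CC.nsum_mem gr_subspace)
       (simp_all add: nprod_def w gr_A gr_B subspace_neg[OF gr_subspace])
qed

lemma gr_P: "w \<in> gr q \<Longrightarrow> P n w \<in> gr q"
  unfolding P_def by (intro BB.nsum_mem gr_subspace) (simp add: nprod_BB gr_B)

lemma gr_S: "w \<in> gr q \<Longrightarrow> S j w \<in> gr (\<not> q)"
  unfolding S_def by (intro CB.nsum_mem gr_subspace) (simp add: nprod_CB gr_B gr_C)

lemma smooth_T: "smooth_modes T"
  unfolding smooth_modes_def
proof
  fix w
  have "smooth_modes TA"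
    unfolding TA_def[abs_def] by (rule AB.nsum_smooth[of 0]) (simp add: AB)
  then have "\<forall>\<^sub>F n in at_top. TA n w = 0"
    by (simp add: smooth_modes_def)
  moreover have "smooth_modes (nsum (-1) cc_coeff C C)"
    by (rule CC.nsum_smooth[of "-1"]) (subst CC, simp)
  then have "\<forall>\<^sub>F n in at_top. nsum (-1) cc_coeff C C n w = 0"
    by (simp add: smooth_modes_def)
  then have "\<forall>\<^sub>F n in at_top. TC n w = 0"
    unfolding TC_def by (rule eventually_at_top_int_shift)
  ultimately show "\<forall>\<^sub>F n in at_top. T n w = 0"
    by (rule eventually_elim2) (simp add: T_def)
qed

lemma smooth_P: "smooth_modes P"
  unfolding P_def[abs_def] by (rule BB.nsum_smooth[of 0]) (simp add: BB)

lemma smooth_S: "smooth_modes S"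
  unfolding S_def[abs_def] by (rule CB.nsum_smooth[of 0]) (simp add: BC)

section \<open>The module over the BMS superalgebra\<close>

primrec bms_op :: "complex \<Rightarrow> bms \<Rightarrow> 'w \<Rightarrow> 'w" where
  "bms_op \<rho> (gL n) = L \<rho> n"
| "bms_op \<rho> (gM n) = M \<rho> n"
| "bms_op \<rho> (gQ j) = Q \<rho> j"
| "bms_op \<rho> gC1 = (\<lambda>w. (5 / 2) *s w)"
| "bms_op \<rho> gC2 = (\<lambda>w. (- 12 * \<rho>\<^sup>2) *s w)"

lemma linear_bms_op: "linear_op (bms_op \<rho> b)"
  by (cases b) (simp_all only: bms_op.simps linear_L linear_M linear_Q linear_op_scale)

lemma bms_module_bms_op: "bms_module scale gr (free_act scale (bms_op \<rho>))"
proof (rule lie_supermodule_free_act[OF bms_lie_superalgebra linear_bms_op])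
  fix b q w assume w: "w \<in> gr q"
  note sub = subspace_diff[OF gr_subspace] subspace_scale[OF gr_subspace] subspace_neg[OF gr_subspace]
  show "bms_op \<rho> b w \<in> gr (bms_odd b \<noteq> q)"
    using w by (cases b) (auto simp: L_def M_def Q_def intro!: sub gr_T gr_P gr_S gr_A gr_B gr_C)
next
  fix i j w
  note act = free_act_add free_act_vscale free_act_gen free_act_0 free_act_uminus free_act_diff
  note lin = linear_opD[OF linear_L] linear_opD[OF linear_M] linear_opD[OF linear_Q]
  show "free_act scale (bms_op \<rho>) (bms_br_gen i j) w = bms_op \<rho> i (bms_op \<rho> j w)
      - koszul (bms_odd i) (bms_odd j) *s bms_op \<rho> j (bms_op \<rho> i w)"
    \<comment> \<open>The negated copies supply the brackets with \<open>L\<close> on the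
      right.\<close>
    using L_L L_M L_Q Q_Q M_M M_Q
      L_M[THEN arg_cong[where f = uminus], unfolded minus_diff_eq]
      L_Q[THEN arg_cong[where f = uminus], unfolded minus_diff_eq]
    by (cases i; cases j) (simp_all add: act lin koszul_def mult.commute del: vscale_single)
qed

lemma bms_smooth_bms_op: "bms_smooth (free_act scale (bms_op \<rho>))"
  unfolding bms_smooth_def free_act_gen bms_op.simps
proof (intro allI eventually_conj)
  fix w
  have *: "\<forall>\<^sub>F n in at_top. A n w = 0" "\<forall>\<^sub>F n in at_top. B n w = 0" "\<forall>\<^sub>F n in at_top. C n w = 0"
    "\<forall>\<^sub>F n in at_top. T n w = 0" "\<forall>\<^sub>F n in at_top. P n w = 0" "\<forall>\<^sub>F n in at_top. S n w = 0"
    using smooth_A smooth_B smooth_C smooth_T smooth_P smooth_S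
    by (simp_all add: smooth_modes_def)
  show "\<forall>\<^sub>F n in at_top. L \<rho> n w = 0" "\<forall>\<^sub>F n in at_top. M \<rho> n w = 0"
    using eventually_conj[OF *(1,4)] eventually_conj[OF *(2,5)]
    by (auto simp: L_def M_def elim: eventually_mono)
  have "\<forall>\<^sub>F n in at_top. Q \<rho> n w = 0"
    using eventually_conj[OF *(3,6)] by (auto simp: Q_def elim: eventually_mono)
  then show "\<forall>\<^sub>F n in at_top. Q \<rho> (n - 1) w = 0"
    by (rule eventually_at_top_int_shift)
qed

end

section \<open>From a smooth level one module to the realisation\<close>

lemma heisenberg_clifford_modes_of_module:
  assumes "hc_module scale gr act" and smooth: "hc_smooth act" and level: "hc_level scale act 1"
  shows "heisenberg_clifford_modes scale gr (\<lambda>n. act (gen (hA n))) (\<lambda>n. act (gen (hB n))) (\<lambda>n. act (gen (hC n)))"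
proof -
  interpret W: lie_supermodule vscale hc_gr hc_br scale gr act by fact
  have K: "act (gen hK) w = w" for w
    using level by (simp add: hc_level_def)
  have free: "gen b \<in> hc_gr (hc_odd b)" for b
    by (simp add: free_gr_def)
  have act: "act (vscale c x) w = scale c (act x w)" "act (- x) w = - act x w" "act 0 w = 0" for c x w
    using W.act_linear_left[of w] module_hom.scale module_hom.neg module_hom.zero
    by (fastforce simp: Vector_Spaces.linear_def)+
  have br: "act (gen i) (act (gen j) w) = act (hc_br_gen i j) w
      + scale (koszul (hc_odd i) (hc_odd j)) (act (gen j) (act (gen i) w))" for i j w
    using W.act_br[OF free free, of i j w] by simp
  have deg: "w \<in> gr q \<Longrightarrow> act (gen b) w \<in> gr (hc_odd b \<noteq> q)" for b q w
    by (rule W.act_gr[OF free])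
  show ?thesis
  proof (intro heisenberg_clifford_modes.intro heisenberg_clifford_modes_axioms.intro
      W.W.super_space_axioms W.act_linear_right)
    show "smooth_modes (\<lambda>n. act (gen (hA n)))" "smooth_modes (\<lambda>n. act (gen (hB n)))"
      "smooth_modes (\<lambda>n. act (gen (hC n)))"
      using smooth by (auto simp: hc_smooth_def smooth_modes_def)
  next
    fix w q k assume "w \<in> gr q"
    then show "act (gen (hA k)) w \<in> gr q" "act (gen (hB k)) w \<in> gr q" "act (gen (hC k)) w \<in> gr (\<not> q)"
      using deg[of w q "hA k"] deg[of w q "hB k"] deg[of w q "hC k"] by simp_all
  next
    fix j k w
    show "act (gen (hA j)) (act (gen (hA k)) w) = act (gen (hA k)) (act (gen (hA j)) w)"
      "act (gen (hB j)) (act (gen (hB k)) w) = act (gen (hB k)) (act (gen (hB j)) w)"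
      "act (gen (hA j)) (act (gen (hC k)) w) = act (gen (hC k)) (act (gen (hA j)) w)"
      "act (gen (hB j)) (act (gen (hC k)) w) = act (gen (hC k)) (act (gen (hB j)) w)"
      "act (gen (hA j)) (act (gen (hB k)) w) = act (gen (hB k)) (act (gen (hA j)) w)
        + scale (if j + k = 0 then of_int j else 0) w"
      using br[of "hA j" "hA k" w] br[of "hB j" "hB k" w] br[of "hA j" "hC k" w] br[of "hB j" "hC k" w]
        br[of "hA j" "hB k" w]
      by (simp_all add: act K koszul_def del: vscale_single)
    have "j + k + 1 = 0 \<longleftrightarrow> j + k = -1" by linarith
    then show "act (gen (hC j)) (act (gen (hC k)) w) = - act (gen (hC k)) (act (gen (hC j)) w)
        + scale (if j + k = -1 then 1 else 0) w"
      using br[of "hC j" "hC k" w] by (simp add: act K koszul_def del: vscale_single)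
  qed
qed

theorem theorem5p7:
  fixes \<rho> :: complex
    and scale :: "complex \<Rightarrow> 'w::ab_group_add \<Rightarrow> 'w"
    and gr :: "bool \<Rightarrow> 'w set"
    and act :: "(hc \<Rightarrow>\<^sub>0 complex) \<Rightarrow> 'w \<Rightarrow> 'w"
  assumes "hc_module scale gr act"
    and "hc_smooth act"
    and "hc_level scale act 1"
  shows "(\<forall>n w. finite {m. normal_ab act m (n - m) w \<noteq> 0})
    \<and> (\<forall>n w. finite {k. normal_cc act k (n - 1 - k) w \<noteq> 0})
    \<and> (\<forall>n w. finite {m. act (gen (hB m)) (act (gen (hB (n - m))) w) \<noteq> 0})
    \<and> (\<forall>j w. finite {k. act (gen (hB (j - k))) (act (gen (hC k)) w) \<noteq> 0})
    \<and> (\<exists>act'.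
        bms_module scale gr act'
      \<and> bms_smooth act'
      \<and> bms_central_charge scale act' (5 / 2) (- 12 * \<rho>\<^sup>2)
      \<and> (\<forall>n w. act' (gen (gL n)) w =
            Sum_any (\<lambda>m. normal_ab act m (n - m) w)
          - scale (of_int (n + 1) * \<rho>) (act (gen (hA n)) w)
          - scale (1 / 2) (Sum_any (\<lambda>k. scale (half k + 1 / 2) (normal_cc act k (n - 1 - k) w))))
      \<and> (\<forall>n w. act' (gen (gM n)) w =
            scale (1 / 2) (Sum_any (\<lambda>m. act (gen (hB m)) (act (gen (hB (n - m))) w)))
          - scale (of_int (n + 1) * \<rho>) (act (gen (hB n)) w))
      \<and> (\<forall>j w. act' (gen (gQ j)) w =
            Sum_any (\<lambda>k. act (gen (hB (j - k))) (act (gen (hC k)) w))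
          - scale (2 * (half j + 1 / 2) * \<rho>) (act (gen (hC j)) w)))"
proof -
  interpret heisenberg_clifford_modes scale gr "\<lambda>n. act (gen (hA n))" "\<lambda>n. act (gen (hB n))"
    "\<lambda>n. act (gen (hC n))"
    using assms by (rule heisenberg_clifford_modes_of_module)
  let ?A = "\<lambda>n. act (gen (hA n))" and ?B = "\<lambda>n. act (gen (hB n))" and ?C = "\<lambda>n. act (gen (hC n))"
  have ab: "normal_ab act i j w = nprod 1 ?A ?B i j w" for i j w
    by (simp add: normal_ab_def nprod_def)
  have cc: "normal_cc act i j w = nprod (-1) ?C ?C i j w" for i j w
    by (simp add: normal_cc_def nprod_def)
  \<comment> \<open>\<open>Sum_any\<close> defaults to 0 on infinite support; finiteness certifies
    that the sums are genuine.\<close>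
  have fin: "finite {m. normal_ab act m (n - m) w \<noteq> 0}"
    "finite {k. normal_cc act k (n - 1 - k) w \<noteq> 0}"
    "finite {m. act (gen (hB m)) (act (gen (hB (n - m))) w) \<noteq> 0}"
    "finite {k. act (gen (hB (n - k))) (act (gen (hC k)) w) \<noteq> 0}" for n w
    using AB.finite_nprod[of 1 n w] CC.finite_nprod[of "-1" "n - 1" w] BB.finite_nprod[of 1 n w]
      CB.finite_nprod[of 1 n w]
    by (simp_all add: ab cc nprod_BB nprod_CB)
  have T_eq: "T n w = Sum_any (\<lambda>m. normal_ab act m (n - m) w)
      - scale (1 / 2) (Sum_any (\<lambda>k. scale (half k + 1 / 2) (normal_cc act k (n - 1 - k) w)))" for n w
  proof -
    have "cc_coeff k = - 1 / 2 * (half k + 1 / 2)" for k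
      by (simp add: cc_coeff_def half_def add_divide_distrib)
    then have "TC n w = scale (- 1 / 2) (nsum (-1) (\<lambda>k. half k + 1 / 2) ?C ?C (n - 1) w)"
      unfolding TC_def CC.nsum_scale[symmetric] by presburger
    then show ?thesis by (simp add: T_def TA_def nsum_def ab cc)
  qed
  have P_eq: "P n w = scale (1 / 2) (Sum_any (\<lambda>m. act (gen (hB m)) (act (gen (hB (n - m))) w)))" for n w
    using BB.nsum_scale[of 1 "1 / 2" "\<lambda>_. 1" n w] by (simp add: P_def nsum_def nprod_BB)
  have S_eq: "S j w = Sum_any (\<lambda>k. act (gen (hB (j - k))) (act (gen (hC k)) w))" for j w
    by (simp add: S_def nsum_def nprod_CB)
  let ?act' = "free_act scale (bms_op \<rho>)"
  have "bms_central_charge scale ?act' (5 / 2) (- 12 * \<rho>\<^sup>2)"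
    by (simp add: bms_central_charge_def free_act_gen)
  moreover have "?act' (gen (gL n)) w = Sum_any (\<lambda>m. normal_ab act m (n - m) w)
      - scale (of_int (n + 1) * \<rho>) (act (gen (hA n)) w)
      - scale (1 / 2) (Sum_any (\<lambda>k. scale (half k + 1 / 2) (normal_cc act k (n - 1 - k) w)))" for n w
    unfolding free_act_gen bms_op.simps L_def T_eq by (rule diff_right_commute)
  moreover have "?act' (gen (gM n)) w = scale (1 / 2) (Sum_any (\<lambda>m. act (gen (hB m)) (act (gen (hB (n - m))) w)))
      - scale (of_int (n + 1) * \<rho>) (act (gen (hB n)) w)" for n w
    unfolding free_act_gen bms_op.simps M_def P_eq ..
  moreover have "?act' (gen (gQ j)) w = Sum_any (\<lambda>k. act (gen (hB (j - k))) (act (gen (hC k)) w))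
      - scale (2 * (half j + 1 / 2) * \<rho>) (act (gen (hC j)) w)" for j w
    unfolding free_act_gen bms_op.simps Q_def S_eq ..
  ultimately show ?thesis
    by (intro conjI allI fin exI[of _ ?act'] bms_module_bms_op bms_smooth_bms_op)
qed

end
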